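(* Let $\mathbb{K}$ be an algebraically closed field, let $r\geq 2$ and $d\geq 3$ be integers, and let $k\geq 0$. The Fano scheme $\mathbf{F}_k(X_{r,d})$ is non-empty if and only if $k<r(d-1)$. A non-empty such Fano scheme is connected if and only if $k<r(d-1)-1$.
   Context: $X_{r,d}=V\left(\sum_{i=1}^r\prod_{j=1}^d x_{ij}\right)\subset\mathbb{P}^{rd-1}$, where $x_{ij}$ ($1\le i\le r$, $1\le j\le d$) are the homogeneous coordinates on $\mathbb{P}^{rd-1}$ over $\mathbb{K}$. $\mathbf{F}_k(X)$ is the Fano scheme (fine moduli space) parametrizing projective $k$-planes contained in $X\subset\mathbb{P}^n$. *)

theory Defs
  imports
    "HOL-Analysis.Abstract_Topology"
    "HOL-Library.Poly_Mapping"
    "HOL-Algebra.Ideal"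
    "Jordan_Normal_Form.Determinant"
begin

section \<open>Multivariate polynomials\<close>

type_synonym ('v, 'a) mpoly = "('v \<Rightarrow>\<^sub>0 nat) \<Rightarrow>\<^sub>0 'a"

definition mp_var :: "'v \<Rightarrow> ('v, 'a::comm_ring_1) mpoly" where
  "mp_var v = Poly_Mapping.single (Poly_Mapping.single v 1) 1"

definition mp_const :: "'a \<Rightarrow> ('v, 'a::comm_ring_1) mpoly" where
  "mp_const c = Poly_Mapping.single 0 c"

text \<open>The image of \<open>p\<close> under the ring homomorphism that is \<open>h\<close> on scalars and sends each
  variable \<open>v\<close> to \<open>g v\<close>.\<close>

definition mp_subst :: "('a \<Rightarrow> 'b) \<Rightarrow> ('v \<Rightarrow> 'b) \<Rightarrow> ('v, 'a::comm_ring_1) mpoly \<Rightarrow> 'b::comm_ring_1" where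
  "mp_subst h g p =
     (\<Sum>m\<in>Poly_Mapping.keys p. h (Poly_Mapping.lookup p m) *
        (\<Prod>v\<in>Poly_Mapping.keys m. g v ^ Poly_Mapping.lookup m v))"

definition mon_deg :: "('v \<Rightarrow>\<^sub>0 nat) \<Rightarrow> nat" where
  "mon_deg m = (\<Sum>v\<in>Poly_Mapping.keys m. Poly_Mapping.lookup m v)"

definition hom_part :: "nat \<Rightarrow> ('v, 'a::comm_ring_1) mpoly \<Rightarrow> ('v, 'a) mpoly" where
  "hom_part e p =
     (\<Sum>m | m \<in> Poly_Mapping.keys p \<and> mon_deg m = e. Poly_Mapping.single m (Poly_Mapping.lookup p m))"

text \<open>The polynomial ring in the variables \<open>V\<close>.\<close>

definition mpoly_ring :: "'v set \<Rightarrow> ('v, 'a::comm_ring_1) mpoly ring" where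
  "mpoly_ring V =
     \<lparr>carrier = {p. \<forall>m\<in>Poly_Mapping.keys p. Poly_Mapping.keys m \<subseteq> V},
      monoid.mult = (*), one = 1, zero = 0, add = (+)\<rparr>"

lemma mpoly_ring_simps:
  "x \<otimes>\<^bsub>mpoly_ring V\<^esub> y = x * y" "x \<oplus>\<^bsub>mpoly_ring V\<^esub> y = x + y"
  "\<one>\<^bsub>mpoly_ring V\<^esub> = 1" "\<zero>\<^bsub>mpoly_ring V\<^esub> = 0"
  by (simp_all add: mpoly_ring_def)

lemma mpoly_ring_cring: "cring (mpoly_ring V :: ('v, 'a::comm_ring_1) mpoly ring)"
proof -
  let ?C = "carrier (mpoly_ring V :: ('v, 'a) mpoly ring)"
  have C: "p \<in> ?C \<longleftrightarrow> (\<forall>m\<in>Poly_Mapping.keys p. Poly_Mapping.keys m \<subseteq> V)" for p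
    by (simp add: mpoly_ring_def)
  have add: "p + q \<in> ?C" if "p \<in> ?C" "q \<in> ?C" for p q
    using that Poly_Mapping.keys_add[of p q] unfolding C by blast
  have mult: "p * q \<in> ?C" if pq: "p \<in> ?C" "q \<in> ?C" for p q
    unfolding C
  proof
    fix m assume "m \<in> Poly_Mapping.keys (p * q)"
    then obtain a b where ab: "a \<in> Poly_Mapping.keys p" "b \<in> Poly_Mapping.keys q" "m = a + b"
      using keys_mult[of p q] by blast
    then show "Poly_Mapping.keys m \<subseteq> V"
      using pq Poly_Mapping.keys_add[of a b] unfolding C by blast
  qed
  have neg: "- p \<in> ?C" if "p \<in> ?C" for p
    using that unfolding C
    by (simp add: in_keys_iff)
  show ?thesis
  proof (rule cringI)
    show "abelian_group (mpoly_ring V :: ('v, 'a) mpoly ring)"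
    proof (rule abelian_groupI)
      fix x assume "x \<in> ?C"
      then show "\<exists>y\<in>?C. y \<oplus>\<^bsub>mpoly_ring V\<^esub> x = \<zero>\<^bsub>mpoly_ring V\<^esub>"
        by (intro bexI[of _ "- x"] neg) (simp_all add: mpoly_ring_simps)
    qed (use add in \<open>simp_all add: mpoly_ring_simps algebra_simps\<close>, simp add: C)
    show "Group.comm_monoid (mpoly_ring V :: ('v, 'a) mpoly ring)"
      by (rule comm_monoidI) (use mult in \<open>simp_all add: mpoly_ring_simps algebra_simps\<close>, simp add: C)
  qed (simp add: mpoly_ring_simps algebra_simps)
qed


section \<open>Projective spectra\<close>

text \<open>The points of \<open>Proj K[V]\<close>: the homogeneous primes not containing the irrelevant ideal.\<close>

definition proj_points :: "'v set \<Rightarrow> ('v, 'a::comm_ring_1) mpoly set set" where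
  "proj_points V =
     {P. primeideal P (mpoly_ring V) \<and> (\<forall>p\<in>P. \<forall>e. hom_part e p \<in> P) \<and> \<not> mp_var ` V \<subseteq> P}"

definition proj_closed :: "'v set \<Rightarrow> ('v, 'a::comm_ring_1) mpoly set \<Rightarrow> ('v, 'a) mpoly set set" where
  "proj_closed V S = {P \<in> proj_points V. S \<subseteq> P}"

definition zariski :: "'v set \<Rightarrow> ('v, 'a::comm_ring_1) mpoly set topology" where
  "zariski V =
     topology (\<lambda>U. \<exists>S \<subseteq> carrier (mpoly_ring V). U = proj_points V - proj_closed V S)"

lemma istopology_zariski:
  "istopology (\<lambda>U. \<exists>S \<subseteq> carrier (mpoly_ring V :: ('v, 'a::comm_ring_1) mpoly ring).
     U = proj_points V - proj_closed V S)"
  unfolding istopology_def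
proof (intro conjI allI impI)
  fix U U' :: "('v, 'a) mpoly set set"
  assume "\<exists>S \<subseteq> carrier (mpoly_ring V). U = proj_points V - proj_closed V S"
    and "\<exists>S \<subseteq> carrier (mpoly_ring V). U' = proj_points V - proj_closed V S"
  then obtain S S' where S: "S \<subseteq> carrier (mpoly_ring V)" "U = proj_points V - proj_closed V S"
    and S': "S' \<subseteq> carrier (mpoly_ring V)" "U' = proj_points V - proj_closed V S'"
    by blast
  define T where "T = {p * q | p q. p \<in> S \<and> q \<in> S'}"
  interpret R: cring "mpoly_ring V :: ('v, 'a) mpoly ring" by (rule mpoly_ring_cring)
  have TC: "T \<subseteq> carrier (mpoly_ring V)"
    unfolding T_def using S(1) S'(1) R.m_closed[unfolded mpoly_ring_simps] by blast
  have "T \<subseteq> P \<longleftrightarrow> S \<subseteq> P \<or> S' \<subseteq> P" if P: "P \<in> proj_points V" for P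
  proof -
    interpret primeideal P "mpoly_ring V :: ('v, 'a) mpoly ring"
      using P by (simp add: proj_points_def)
    show ?thesis
    proof
      assume T: "T \<subseteq> P"
      show "S \<subseteq> P \<or> S' \<subseteq> P"
      proof (rule ccontr)
        assume "\<not> ?thesis"
        then obtain p q where pq: "p \<in> S" "p \<notin> P" "q \<in> S'" "q \<notin> P" by blast
        then have "p * q \<in> P" using T unfolding T_def by blast
        with pq S(1) S'(1) show False
          using I_prime[of p q, unfolded mpoly_ring_simps] by blast
      qed
    next
      assume "S \<subseteq> P \<or> S' \<subseteq> P"
      then have "p * q \<in> P" if "p \<in> S" "q \<in> S'" for p q
      proof
        assume "S \<subseteq> P"
        with that S'(1) show ?thesis
          by (intro I_r_closed[of p q, unfolded mpoly_ring_simps]) blast+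
      next
        assume "S' \<subseteq> P"
        with that S(1) show ?thesis
          by (intro I_l_closed[of q p, unfolded mpoly_ring_simps]) blast+
      qed
      then show "T \<subseteq> P" unfolding T_def by blast
    qed
  qed
  then have "U \<inter> U' = proj_points V - proj_closed V T"
    unfolding S(2) S'(2) proj_closed_def by auto
  with TC show "\<exists>S \<subseteq> carrier (mpoly_ring V). U \<inter> U' = proj_points V - proj_closed V S"
    by blast
next
  fix \<K> :: "('v, 'a) mpoly set set set"
  assume "\<forall>K\<in>\<K>. \<exists>S \<subseteq> carrier (mpoly_ring V). K = proj_points V - proj_closed V S"
  then have "\<exists>F. \<forall>K\<in>\<K>. F K \<subseteq> carrier (mpoly_ring V) \<and> K = proj_points V - proj_closed V (F K)"
    by (rule bchoice)
  then obtain F where F: "\<And>K. K \<in> \<K> \<Longrightarrow> F K \<subseteq> carrier (mpoly_ring V)"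
      "\<And>K. K \<in> \<K> \<Longrightarrow> K = proj_points V - proj_closed V (F K)"
    by blast
  have "\<Union>\<K> = (\<Union>K\<in>\<K>. K)"
    by simp
  also have "\<dots> = (\<Union>K\<in>\<K>. proj_points V - proj_closed V (F K))"
    by (rule SUP_cong[OF refl F(2)])
  also have "\<dots> = proj_points V - proj_closed V (\<Union>K\<in>\<K>. F K)"
    by (auto simp: proj_closed_def)
  finally show "\<exists>S \<subseteq> carrier (mpoly_ring V). \<Union>\<K> = proj_points V - proj_closed V S"
    using UN_least[of \<K> F, OF F(1)] by blast
qed

lemma openin_zariski:
  "openin (zariski V) U \<longleftrightarrow>
     (\<exists>S \<subseteq> carrier (mpoly_ring V). U = proj_points V - proj_closed V S)"
  unfolding zariski_def topology_inverse'[OF istopology_zariski] ..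

lemma topspace_zariski: "topspace (zariski V :: ('v, 'a::comm_ring_1) mpoly set topology) = proj_points V"
proof -
  interpret R: cring "mpoly_ring V :: ('v, 'a) mpoly ring" by (rule mpoly_ring_cring)
  have "1 \<notin> P" if P: "P \<in> proj_points V" for P :: "('v, 'a) mpoly set"
  proof -
    interpret primeideal P "mpoly_ring V :: ('v, 'a) mpoly ring"
      using P by (simp add: proj_points_def)
    show ?thesis
      using one_imp_carrier[unfolded mpoly_ring_simps] I_notcarr by blast
  qed
  then have "openin (zariski V) (proj_points V :: ('v, 'a) mpoly set set)"
    unfolding openin_zariski
    by (intro exI[of _ "{1}"]) (use R.one_closed[unfolded mpoly_ring_simps] in \<open>auto simp: proj_closed_def\<close>)
  moreover have "U \<subseteq> proj_points V" if "openin (zariski V) U" for U :: "('v, 'a) mpoly set set"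
    using that unfolding openin_zariski by blast
  ultimately show ?thesis
    by (metis openin_subset openin_topspace subset_antisym)
qed


section \<open>Grassmannians and Fano schemes\<close>

text \<open>Fix homogeneous coordinates \<open>x\<^sub>c\<close>, \<open>c \<in> C\<close>, on a projective space. A projective \<open>k\<close>-plane is
  the row space of a \<open>(k + 1) \<times> C\<close> matrix of rank \<open>k + 1\<close>; its Pluecker coordinates are
  the maximal minors. They are indexed here by all \<open>(k + 1)\<close>-tuples of columns, so that
  the alternating relations among them are part of the Pluecker ideal, which is the kernel of
  the map sending each coordinate to the corresponding minor of the generic matrix.\<close>

definition plucker_index :: "'c set \<Rightarrow> nat \<Rightarrow> 'c list set" where
  "plucker_index C k = {t. length t = Suc k \<and> set t \<subseteq> C}"

definition generic_minor :: "nat \<Rightarrow> 'c list \<Rightarrow> (nat \<times> 'c, 'a::comm_ring_1) mpoly" where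
  "generic_minor k t = det (mat (Suc k) (Suc k) (\<lambda>(a, b). mp_var (a, t ! b)))"

definition plucker_ideal :: "'c set \<Rightarrow> nat \<Rightarrow> ('c list, 'a::comm_ring_1) mpoly set" where
  "plucker_ideal C k =
     {p \<in> carrier (mpoly_ring (plucker_index C k)). mp_subst mp_const (generic_minor k) p = 0}"

text \<open>If \<open>M\<close> is a matrix with rows \<open>0, \<dots>, k\<close> and \<open>M\<^sub>t\<close> is its square submatrix on the columns \<open>t\<close>,
  then by Cramer's rule the \<open>(a, c)\<close> entry of \<open>adj(M\<^sub>t) M\<close> is the minor of \<open>M\<close> on the tuple
  obtained from \<open>t\<close> by replacing its \<open>a\<close>-th entry by \<open>c\<close>. On the standard affine chart of the
  Grassmannian where the coordinate \<open>t\<close> is invertible, the rows of this matrix are thus a basis of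
  the universal plane; on all of the Grassmannian they lie in it. The following is the coordinate
  \<open>x\<^sub>c\<close> of the linear combination of these rows with indeterminate coefficients \<open>s\<^sub>0, \<dots>, s\<^sub>k\<close>:
  a polynomial in the \<open>s\<^sub>a\<close> over the polynomial ring in the Pluecker coordinates.\<close>

definition universal_point ::
    "nat \<Rightarrow> 'c list \<Rightarrow> 'c \<Rightarrow> (nat, ('c list, 'a::comm_ring_1) mpoly) mpoly" where
  "universal_point k t c = (\<Sum>a\<le>k. mp_var a * mp_const (mp_var (t[a := c])))"

text \<open>The universal plane is contained in the hypersurface \<open>V(f)\<close> where all coefficients of \<open>f\<close>
  pulled back to it vanish.\<close>

definition fano_equations ::
    "'c set \<Rightarrow> ('c, 'a::comm_ring_1) mpoly \<Rightarrow> nat \<Rightarrow> ('c list, 'a) mpoly set" where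
  "fano_equations C f k =
     {Poly_Mapping.lookup (mp_subst (\<lambda>b. mp_const (mp_const b)) (universal_point k t) f) m
        | t m. t \<in> plucker_index C k}"

text \<open>The underlying topological space of the Fano scheme of \<open>k\<close>-planes in \<open>V(f)\<close>, as a closed
  subscheme of the Grassmannian in its Pluecker embedding. All its scheme-theoretic points are
  included, not only the closed ones (which are the actual \<open>k\<close>-planes over the ground field).\<close>

definition fano_scheme ::
    "'c set \<Rightarrow> ('c, 'a::comm_ring_1) mpoly \<Rightarrow> nat \<Rightarrow> ('c list, 'a) mpoly set topology" where
  "fano_scheme C f k =
     subtopology (zariski (plucker_index C k))
       (proj_closed (plucker_index C k) (plucker_ideal C k \<union> fano_equations C f k))"


section \<open>The hypersurfaces\<close>

text \<open>Indices start at \<open>0\<close>.\<close>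

definition X_coords :: "nat \<Rightarrow> nat \<Rightarrow> (nat \<times> nat) set" where
  "X_coords r d = {..<r} \<times> {..<d}"

definition X_form :: "nat \<Rightarrow> nat \<Rightarrow> (nat \<times> nat, 'a::comm_ring_1) mpoly" where
  "X_form r d = (\<Sum>i<r. \<Prod>j<d. mp_var (i, j))"

end

theory Submission
  imports Defs
begin

text \<open>All points of the Fano scheme are degenerated to coordinate planes by the torus preserving the
  hypersurface. Let \<open>P\<close> be a point and \<open>w\<close> weights on the coordinates with vanishing row sums. If \<open>t\<close> has
  maximal weight among the Pluecker coordinates not vanishing at \<open>P\<close>, then \<open>t\<close> contains no full row
  \<open>{i} \<times> {..<d}\<close>: otherwise, in the pullback of the form to the chart of \<open>t\<close>, the product of the
  parameters belonging to this row would have the coefficient \<open>p\<^sub>t ^ d\<close> modulo \<open>P\<close>. Hence \<open>t\<close> has at most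
  \<open>r * (d - 1)\<close> elements. If \<open>w\<close> is generic, then \<open>P\<close> and the coordinate plane of \<open>t\<close> moreover have a
  common generization, so they lie in the same component.

  Two coordinate planes in a coordinate subspace of the hypersurface of one dimension more are joined by a
  line in the Fano scheme, and below the maximal dimension such exchanges connect all of them. In the maximal
  dimension, comparing coefficients (this is where \<open>d \<ge> 3\<close> enters) shows that the chart of a coordinate
  plane contains no other point than this plane, so each of these charts is open and closed.\<close>

section \<open>Substitution homomorphisms\<close>

text \<open>Weights with vanishing row sums are exactly those that give every monomial of the form
  weight zero. All equations of the Fano scheme are then homogeneous, so the largest homogeneous
  ideal inside a point of the Fano scheme is again such a point; this ideal is the common
  generization of \<open>P\<close> and its limit plane. Connectedness then needs neither components
  nor paths: a clopen set contains both or neither of two points with a common generization, and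
  this treats closed and non-closed points alike. Genericity means that the weights separate the
  coordinate sets omitting an entry of every row; only then does a single coordinate plane survive
  in top weight. Powers of 3 achieve this, because the sets are encoded by digits -1, 0, 1, whose
  differences are at most 2 in absolute value. In the maximal dimension such a set omits exactly one
  entry per row. A foreign row could disturb the comparison of coefficients only if all its
  \<open>d - 1\<close> remaining entries sat at one and the same position of the tuple, which
  \<open>d >= 3\<close> excludes.\<close>

lemma comm_ring_homI:
  assumes "h 0 = 0" "h 1 = 1" "\<And>x y. h (x + y) = h x + h y" "\<And>x y. h (x * y) = h x * h y"
  shows "comm_ring_hom h"
  by unfold_locales (use assms in auto)

definition mon_eval :: "('v \<Rightarrow> 'b) \<Rightarrow> ('v \<Rightarrow>\<^sub>0 nat) \<Rightarrow> 'b::comm_ring_1" where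
  "mon_eval g m = (\<Prod>v\<in>Poly_Mapping.keys m. g v ^ Poly_Mapping.lookup m v)"

lemma mon_eval_superset:
  assumes "finite A" "Poly_Mapping.keys m \<subseteq> A"
  shows "mon_eval g m = (\<Prod>v\<in>A. g v ^ Poly_Mapping.lookup m v)"
  unfolding mon_eval_def using assms by (intro prod.mono_neutral_left) (auto simp: in_keys_iff)

lemma mon_eval_0 [simp]: "mon_eval g 0 = 1"
  by (simp add: mon_eval_def)

lemma mon_eval_single [simp]: "mon_eval g (Poly_Mapping.single v e) = g v ^ e"
  by (subst mon_eval_superset[of "{v}"]) auto

lemma mon_eval_add: "mon_eval g (m + n) = mon_eval g m * mon_eval g n"
proof -
  let ?A = "Poly_Mapping.keys m \<union> Poly_Mapping.keys n"
  have "mon_eval g l = (\<Prod>v\<in>?A. g v ^ Poly_Mapping.lookup l v)" if "l \<in> {m, n, m + n}" for l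
    using that Poly_Mapping.keys_add[of m n] by (intro mon_eval_superset) auto
  then show ?thesis
    by (simp add: lookup_add power_add prod.distrib)
qed

lemma poly_mapping_sum_single:
  "(\<Sum>m\<in>Poly_Mapping.keys p. Poly_Mapping.single m (Poly_Mapping.lookup p m)) = p"
  by (rule poly_mapping_eqI) (auto simp: lookup_sum lookup_single when_def in_keys_iff)

text \<open>Coefficients may cancel, so the keys of a sum are not the union of the keys; evaluations
  are compared over a fixed finite set containing all keys involved.\<close>

lemma mp_subst_superset:
  assumes "comm_ring_hom h" "finite A" "Poly_Mapping.keys p \<subseteq> A"
  shows "mp_subst h g p = (\<Sum>m\<in>A. h (Poly_Mapping.lookup p m) * mon_eval g m)"
proof -
  interpret comm_ring_hom h by fact
  show ?thesis
    unfolding mp_subst_def mon_eval_def[symmetric] using assms(2,3)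
    by (intro sum.mono_neutral_left) (auto simp: in_keys_iff)
qed

lemma mp_subst_single:
  assumes "comm_ring_hom h"
  shows "mp_subst h g (Poly_Mapping.single m c) = h c * mon_eval g m"
  by (subst mp_subst_superset[OF assms, of "{m}"]) auto

lemma comm_ring_hom_mp_subst:
  fixes h :: "'a::comm_ring_1 \<Rightarrow> 'b::comm_ring_1" and g :: "'v \<Rightarrow> 'b"
  assumes h: "comm_ring_hom h"
  shows "comm_ring_hom (mp_subst h g)"
proof -
  interpret comm_ring_hom h by fact
  have add: "mp_subst h g (p + q) = mp_subst h g p + mp_subst h g q" for p q
  proof -
    let ?A = "Poly_Mapping.keys p \<union> Poly_Mapping.keys q"
    have "mp_subst h g l = (\<Sum>m\<in>?A. h (Poly_Mapping.lookup l m) * mon_eval g m)"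
      if "l \<in> {p, q, p + q}" for l
      using that Poly_Mapping.keys_add[of p q] by (intro mp_subst_superset[OF h]) auto
    then show ?thesis
      by (simp add: lookup_add hom_add sum.distrib distrib_right)
  qed
  have zero: "mp_subst h g 0 = 0"
    by (simp add: mp_subst_def)
  have sum: "mp_subst h g (\<Sum>x\<in>A. f x) = (\<Sum>x\<in>A. mp_subst h g (f x))"
    for A and f :: "('v \<Rightarrow>\<^sub>0 nat) \<Rightarrow> ('v, 'a) mpoly"
    by (induction A rule: infinite_finite_induct) (simp_all add: add zero)
  show ?thesis
  proof (rule comm_ring_homI[OF zero _ add])
    show "mp_subst h g 1 = 1"
      using mp_subst_single[OF h, of g 0 1] by simp
  next
    fix p q :: "('v, 'a) mpoly"
    let ?s = "\<lambda>p m. Poly_Mapping.single m (Poly_Mapping.lookup p m)"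
    have "mp_subst h g (p * q) = mp_subst h g ((\<Sum>m\<in>Poly_Mapping.keys p. ?s p m) *
      (\<Sum>n\<in>Poly_Mapping.keys q. ?s q n))"
      by (simp only: poly_mapping_sum_single)
    also have "\<dots> = (\<Sum>m\<in>Poly_Mapping.keys p. \<Sum>n\<in>Poly_Mapping.keys q.
        (h (Poly_Mapping.lookup p m) * mon_eval g m) * (h (Poly_Mapping.lookup q n) * mon_eval g n))"
      by (simp add: sum_product sum mult_single mp_subst_single[OF h] mon_eval_add hom_mult ac_simps)
    also have "\<dots> = mp_subst h g p * mp_subst h g q"
      by (simp add: mp_subst_superset[OF h _ subset_refl] sum_product)
    finally show "mp_subst h g (p * q) = mp_subst h g p * mp_subst h g q" .
  qed
qed

lemma comm_ring_hom_id: "comm_ring_hom (\<lambda>x. x)"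
  by (rule comm_ring_homI) auto

lemma comm_ring_hom_mp_const: "comm_ring_hom mp_const"
  by (rule comm_ring_homI) (auto simp: mp_const_def single_add mult_single)

lemma mp_const_0 [simp]: "mp_const 0 = 0"
  by (simp add: mp_const_def)

lemma comm_ring_hom_comp:
  assumes "comm_ring_hom f" "comm_ring_hom g"
  shows "comm_ring_hom (\<lambda>x. f (g x))"
proof -
  interpret f: comm_ring_hom f by fact
  interpret g: comm_ring_hom g by fact
  show ?thesis
    by (rule comm_ring_homI) (auto simp: f.hom_add g.hom_add f.hom_mult g.hom_mult)
qed

lemma mp_subst_var [simp]: "comm_ring_hom h \<Longrightarrow> mp_subst h g (mp_var v) = g v"
  by (simp add: mp_var_def mp_subst_single comm_ring_hom.axioms comm_ring_hom_def
      ring_hom_def semiring_hom_def monoid_mult_hom_def one_hom_def)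

lemma mp_subst_const [simp]: "comm_ring_hom h \<Longrightarrow> mp_subst h g (mp_const c) = h c"
  by (simp add: mp_const_def mp_subst_single)

lemma hom_mp_subst:
  assumes f: "comm_ring_hom f"
  shows "f (mp_subst h g p) = mp_subst (\<lambda>c. f (h c)) (\<lambda>v. f (g v)) p"
proof -
  interpret f: comm_ring_hom f by fact
  show ?thesis
    by (simp add: mp_subst_def f.hom_sum f.hom_mult f.hom_prod f.hom_power)
qed

lemma mp_subst_mp_subst:
  assumes "comm_ring_hom h"
  shows "mp_subst h g (mp_subst mp_const G p) = mp_subst h (\<lambda>v. mp_subst h g (G v)) p"
  by (subst hom_mp_subst[OF comm_ring_hom_mp_subst[OF assms]]) (simp add: assms)

section \<open>Gradings\<close>

definition wdeg :: "('v \<Rightarrow> int) \<Rightarrow> ('v \<Rightarrow>\<^sub>0 nat) \<Rightarrow> int" where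
  "wdeg w m = (\<Sum>v\<in>Poly_Mapping.keys m. int (Poly_Mapping.lookup m v) * w v)"

lemma wdeg_superset:
  assumes "finite A" "Poly_Mapping.keys m \<subseteq> A"
  shows "wdeg w m = (\<Sum>v\<in>A. int (Poly_Mapping.lookup m v) * w v)"
  unfolding wdeg_def using assms by (intro sum.mono_neutral_left) (auto simp: in_keys_iff)

lemma wdeg_0 [simp]: "wdeg w 0 = 0"
  by (simp add: wdeg_def)

lemma wdeg_single [simp]: "wdeg w (Poly_Mapping.single v e) = int e * w v"
  by (subst wdeg_superset[of "{v}"]) auto

lemma wdeg_add: "wdeg w (m + n) = wdeg w m + wdeg w n"
proof -
  let ?A = "Poly_Mapping.keys m \<union> Poly_Mapping.keys n"
  have "wdeg w l = (\<Sum>v\<in>?A. int (Poly_Mapping.lookup l v) * w v)" if "l \<in> {m, n, m + n}" for l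
    using that Poly_Mapping.keys_add[of m n] by (intro wdeg_superset) auto
  then show ?thesis
    by (simp add: lookup_add sum.distrib distrib_right)
qed

lemma wdeg_sum: "wdeg w (\<Sum>x\<in>A. f x) = (\<Sum>x\<in>A. wdeg w (f x))"
  by (induction A rule: infinite_finite_induct) (simp_all add: wdeg_add)

definition wcomp :: "('v \<Rightarrow> int) \<Rightarrow> int \<Rightarrow> ('v, 'a::comm_ring_1) mpoly \<Rightarrow> ('v, 'a) mpoly" where
  "wcomp w n p =
     (\<Sum>m | m \<in> Poly_Mapping.keys p \<and> wdeg w m = n. Poly_Mapping.single m (Poly_Mapping.lookup p m))"

lemma lookup_wcomp:
  "Poly_Mapping.lookup (wcomp w n p) m = (if wdeg w m = n then Poly_Mapping.lookup p m else 0)"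
proof -
  have fin: "finite {m. m \<in> Poly_Mapping.keys p \<and> wdeg w m = n}"
    by (rule finite_subset[of _ "Poly_Mapping.keys p"]) auto
  show ?thesis
    by (auto simp: wcomp_def lookup_sum lookup_single when_def in_keys_iff fin)
qed

lemma keys_wcomp: "Poly_Mapping.keys (wcomp w n p) = {m \<in> Poly_Mapping.keys p. wdeg w m = n}"
  by (auto simp: in_keys_iff lookup_wcomp split: if_splits)

lemma wcomp_0 [simp]: "wcomp w n 0 = 0"
  by (simp add: wcomp_def)

lemma wcomp_add: "wcomp w n (p + q) = wcomp w n p + wcomp w n q"
  by (rule poly_mapping_eqI) (simp add: lookup_wcomp lookup_add)

lemma wcomp_sum: "wcomp w n (\<Sum>x\<in>A. f x) = (\<Sum>x\<in>A. wcomp w n (f x))"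
  by (induction A rule: infinite_finite_induct) (simp_all add: wcomp_add)

lemma wcomp_commute: "wcomp w n (wcomp w' n' p) = wcomp w' n' (wcomp w n p)"
  by (rule poly_mapping_eqI) (simp add: lookup_wcomp)

lemma sum_wcomp: "(\<Sum>n\<in>wdeg w ` Poly_Mapping.keys p. wcomp w n p) = p"
  by (rule poly_mapping_eqI) (auto simp: lookup_sum lookup_wcomp in_keys_iff)

text \<open>Puts the standard grading under the same theory as the torus gradings, with which it
  commutes by \<open>wcomp_commute\<close>.\<close>

lemma hom_part_eq_wcomp:
  fixes p :: "('v, 'a::comm_ring_1) mpoly"
  shows "hom_part e p = wcomp (\<lambda>_. 1) (int e) p"
proof -
  have "int (mon_deg m) = wdeg (\<lambda>_. 1) m" for m :: "'v \<Rightarrow>\<^sub>0 nat"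
    by (simp add: mon_deg_def wdeg_def)
  then have "mon_deg m = e \<longleftrightarrow> wdeg (\<lambda>_. 1) m = int e" for m :: "'v \<Rightarrow>\<^sub>0 nat"
    by (metis of_nat_eq_iff)
  then show ?thesis
    by (simp add: hom_part_def wcomp_def)
qed

definition whomog :: "('v \<Rightarrow> int) \<Rightarrow> int \<Rightarrow> ('v, 'a::comm_ring_1) mpoly \<Rightarrow> bool" where
  "whomog w n p \<longleftrightarrow> (\<forall>m\<in>Poly_Mapping.keys p. wdeg w m = n)"

lemma wcomp_whomog: "whomog w n p \<Longrightarrow> wcomp w n' p = (if n' = n then p else 0)"
  by (rule poly_mapping_eqI) (auto simp: lookup_wcomp whomog_def in_keys_iff)

lemma whomog_wcomp: "whomog w n (wcomp w n p)"
  by (auto simp: whomog_def keys_wcomp)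

lemma whomog_0 [simp]: "whomog w n 0"
  by (simp add: whomog_def)

lemma whomog_add: "whomog w n p \<Longrightarrow> whomog w n q \<Longrightarrow> whomog w n (p + q)"
  using Poly_Mapping.keys_add[of p q] unfolding whomog_def by blast

lemma whomog_sum: "(\<And>x. x \<in> A \<Longrightarrow> whomog w n (f x)) \<Longrightarrow> whomog w n (\<Sum>x\<in>A. f x)"
  by (induction A rule: infinite_finite_induct) (auto intro: whomog_add)

lemma whomog_mult: "whomog w n p \<Longrightarrow> whomog w n' q \<Longrightarrow> whomog w (n + n') (p * q)"
  using keys_mult[of p q] unfolding whomog_def by (fastforce simp: wdeg_add)

lemma whomog_const: "whomog w 0 (mp_const c)"
  by (auto simp: whomog_def mp_const_def)

lemma whomog_1: "whomog w 0 1"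
  using whomog_const[of w 1] by (simp add: mp_const_def)

lemma whomog_of_int: "whomog w 0 (of_int z)"
proof -
  interpret comm_ring_hom "mp_const :: 'b \<Rightarrow> ('a, 'b) mpoly" by (rule comm_ring_hom_mp_const)
  show ?thesis using whomog_const[of w "of_int z :: 'b"] by (simp add: hom_of_int)
qed

lemma whomog_var: "whomog w (w v) (mp_var v)"
  by (auto simp: whomog_def mp_var_def)

lemma whomog_prod: "(\<And>x. x \<in> A \<Longrightarrow> whomog w (n x) (f x)) \<Longrightarrow> whomog w (\<Sum>x\<in>A. n x) (\<Prod>x\<in>A. f x)"
  by (induction A rule: infinite_finite_induct) (auto intro: whomog_mult simp: whomog_1)

lemma whomog_power: "whomog w n p \<Longrightarrow> whomog w (int e * n) (p ^ e)"
  using whomog_prod[of "{..<e}" w "\<lambda>_. n" "\<lambda>_. p"] by simp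

lemma whomog_mon_eval:
  assumes "\<And>v. whomog w' (w v) (g v)"
  shows "whomog w' (wdeg w m) (mon_eval g m)"
  unfolding wdeg_def mon_eval_def by (intro whomog_prod whomog_power assms)

text \<open>Substituting homogeneous elements sends each monomial to an element of matching degree.
  Hence the kernel is stable under taking components; this is applied to the generic minors, whose
  kernel is the Pluecker ideal.\<close>

lemma wcomp_mp_subst:
  assumes "\<And>v. whomog w' (w v) (g v)"
  shows "wcomp w' n (mp_subst mp_const g p) = mp_subst mp_const g (wcomp w n p)"
proof -
  note h = comm_ring_hom_mp_const
  let ?K = "Poly_Mapping.keys p" and ?t = "\<lambda>m. mp_const (Poly_Mapping.lookup p m) * mon_eval g m"
  have hom: "whomog w' (wdeg w m) (?t m)" for m
    using whomog_mult[OF whomog_const whomog_mon_eval[of w' w g, OF assms]] by simp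
  have "wcomp w' n (mp_subst mp_const g p) = (\<Sum>m\<in>?K. wcomp w' n (?t m))"
    by (simp add: mp_subst_superset[OF h _ subset_refl] wcomp_sum)
  also have "\<dots> = (\<Sum>m\<in>?K. mp_const (Poly_Mapping.lookup (wcomp w n p) m) * mon_eval g m)"
    by (intro sum.cong refl) (simp add: wcomp_whomog[OF hom] lookup_wcomp)
  also have "\<dots> = mp_subst mp_const g (wcomp w n p)"
    by (rule mp_subst_superset[OF h, symmetric]) (auto simp: keys_wcomp)
  finally show ?thesis .
qed

section \<open>Homogeneous cores of prime ideals\<close>

lemma mpoly_ring_mem:
  "p \<in> carrier (mpoly_ring V) \<longleftrightarrow> (\<forall>m\<in>Poly_Mapping.keys p. Poly_Mapping.keys m \<subseteq> V)"
  by (simp add: mpoly_ring_def)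

lemma mpoly_closed [intro, simp]:
  shows mpoly_0_closed: "0 \<in> carrier (mpoly_ring V)"
    and mpoly_1_closed: "1 \<in> carrier (mpoly_ring V)"
    and mpoly_const_closed: "mp_const c \<in> carrier (mpoly_ring V)"
    and mpoly_var_closed: "v \<in> V \<Longrightarrow> mp_var v \<in> carrier (mpoly_ring V)"
    and mpoly_wcomp_closed: "p \<in> carrier (mpoly_ring V) \<Longrightarrow> wcomp w n p \<in> carrier (mpoly_ring V)"
  by (auto simp: mpoly_ring_mem mp_const_def mp_var_def keys_wcomp)

lemma mpoly_add_closed [intro, simp]:
    "p \<in> carrier (mpoly_ring V) \<Longrightarrow> q \<in> carrier (mpoly_ring V) \<Longrightarrow> p + q \<in> carrier (mpoly_ring V)"
  and mpoly_mult_closed [intro, simp]: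
    "p \<in> carrier (mpoly_ring V) \<Longrightarrow> q \<in> carrier (mpoly_ring V) \<Longrightarrow> p * q \<in> carrier (mpoly_ring V)"
proof -
  interpret cring "mpoly_ring V :: ('a, 'b) mpoly ring" by (rule mpoly_ring_cring)
  show "p \<in> carrier (mpoly_ring V) \<Longrightarrow> q \<in> carrier (mpoly_ring V) \<Longrightarrow> p + q \<in> carrier (mpoly_ring V)"
    using a_closed[of p q] by (simp add: mpoly_ring_simps)
  show "p \<in> carrier (mpoly_ring V) \<Longrightarrow> q \<in> carrier (mpoly_ring V) \<Longrightarrow> p * q \<in> carrier (mpoly_ring V)"
    using m_closed[of p q] by (simp add: mpoly_ring_simps)
qed

lemma mpoly_uminus_closed [intro, simp]:
  "p \<in> carrier (mpoly_ring V) \<Longrightarrow> - p \<in> carrier (mpoly_ring V)"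
  by (simp add: mpoly_ring_mem in_keys_iff)

lemma mpoly_diff_closed [intro, simp]:
  "p \<in> carrier (mpoly_ring V) \<Longrightarrow> q \<in> carrier (mpoly_ring V) \<Longrightarrow> p - q \<in> carrier (mpoly_ring V)"
  using mpoly_add_closed[of p V "- q"] by simp

lemma mpoly_power_closed [intro, simp]:
  "p \<in> carrier (mpoly_ring V) \<Longrightarrow> p ^ e \<in> carrier (mpoly_ring V)"
  by (induction e) auto

lemma mpoly_sum_closed [intro]:
  "(\<And>x. x \<in> A \<Longrightarrow> f x \<in> carrier (mpoly_ring V)) \<Longrightarrow> (\<Sum>x\<in>A. f x) \<in> carrier (mpoly_ring V)"
  by (induction A rule: infinite_finite_induct) auto

lemma mpoly_prod_closed [intro]:
  "(\<And>x. x \<in> A \<Longrightarrow> f x \<in> carrier (mpoly_ring V)) \<Longrightarrow> (\<Prod>x\<in>A. f x) \<in> carrier (mpoly_ring V)"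
  by (induction A rule: infinite_finite_induct) auto

locale mpoly_prime =
  fixes V :: "'v set" and P :: "('v, 'a::comm_ring_1) mpoly set"
  assumes primeideal: "primeideal P (mpoly_ring V)"
begin

lemma mem_carrier: "p \<in> P \<Longrightarrow> p \<in> carrier (mpoly_ring V)"
  by (rule ideal.Icarr[OF primeideal.axioms(1)[OF primeideal]])

lemma zero_mem [simp]: "0 \<in> P"
  using additive_subgroup.zero_closed[OF ideal.axioms(1)[OF primeideal.axioms(1)[OF primeideal]]]
  by (simp add: mpoly_ring_simps)

lemma add_mem: "p \<in> P \<Longrightarrow> q \<in> P \<Longrightarrow> p + q \<in> P"
  using additive_subgroup.a_closed[OF ideal.axioms(1)[OF primeideal.axioms(1)[OF primeideal]], of p q]
  by (simp add: mpoly_ring_simps)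

lemma mult_mem_left: "p \<in> P \<Longrightarrow> q \<in> carrier (mpoly_ring V) \<Longrightarrow> q * p \<in> P"
  using ideal.I_l_closed[OF primeideal.axioms(1)[OF primeideal], of p q]
  by (simp add: mpoly_ring_simps)

lemma mult_mem_right: "p \<in> P \<Longrightarrow> q \<in> carrier (mpoly_ring V) \<Longrightarrow> p * q \<in> P"
  using mult_mem_left[of p q] by (simp add: mult.commute)

lemma uminus_mem: "p \<in> P \<Longrightarrow> - p \<in> P"
  using mult_mem_left[of p "- 1"] by simp

lemma diff_mem: "p \<in> P \<Longrightarrow> q \<in> P \<Longrightarrow> p - q \<in> P"
  using add_mem[of p "- q"] uminus_mem[of q] by simp

lemma sum_mem: "(\<And>x. x \<in> A \<Longrightarrow> f x \<in> P) \<Longrightarrow> (\<Sum>x\<in>A. f x) \<in> P"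
  by (induction A rule: infinite_finite_induct) (auto intro: add_mem)

lemma prime_mem:
  "p * q \<in> P \<Longrightarrow> p \<in> carrier (mpoly_ring V) \<Longrightarrow> q \<in> carrier (mpoly_ring V) \<Longrightarrow> p \<in> P \<or> q \<in> P"
  using primeideal.I_prime[OF primeideal, of p q] by (simp add: mpoly_ring_simps)

lemma one_notin: "1 \<notin> P"
  using ideal.one_imp_carrier[OF primeideal.axioms(1)[OF primeideal]] primeideal.I_notcarr[OF primeideal]
  by (auto simp: mpoly_ring_simps)

lemma power_mem: "p ^ e \<in> P \<Longrightarrow> p \<in> carrier (mpoly_ring V) \<Longrightarrow> p \<in> P"
proof (induction e)
  case (Suc e)
  then show ?case using prime_mem[of p "p ^ e"] mpoly_power_closed by auto
qed (simp add: one_notin)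

lemma prod_mem:
  assumes "finite A" "x \<in> A" "f x \<in> P" "\<And>y. y \<in> A \<Longrightarrow> f y \<in> carrier (mpoly_ring V)"
  shows "(\<Prod>y\<in>A. f y) \<in> P"
  unfolding prod.remove[OF assms(1,2)] using assms by (intro mult_mem_right mpoly_prod_closed) auto

text \<open>Isolates one term of a Fano coefficient once all other terms are known to lie in
  \<open>P\<close>.\<close>

lemma sum_mem_iff:
  assumes "finite A" "x \<in> A" "\<And>y. y \<in> A \<Longrightarrow> y \<noteq> x \<Longrightarrow> f y \<in> P"
  shows "(\<Sum>y\<in>A. f y) \<in> P \<longleftrightarrow> f x \<in> P"
proof -
  have rest: "(\<Sum>y\<in>A - {x}. f y) \<in> P"
    using assms(3) by (intro sum_mem) auto
  have "(\<Sum>y\<in>A. f y) = f x + (\<Sum>y\<in>A - {x}. f y)"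
    using assms by (simp add: sum.remove)
  then show ?thesis
    using add_mem[OF _ rest, of "f x"] diff_mem[OF _ rest, of "\<Sum>y\<in>A. f y"] by auto
qed

lemma mp_const_notin:
  assumes "c * d = 1"
  shows "mp_const c \<notin> P"
proof
  assume "mp_const c \<in> P"
  then have "mp_const c * mp_const d \<in> P" by (intro mult_mem_right) auto
  then show False using one_notin assms by (simp add: mp_const_def mult_single)
qed

end

lemma primeideal_mpolyI:
  fixes P :: "('v, 'a::comm_ring_1) mpoly set"
  assumes "P \<subseteq> carrier (mpoly_ring V)" "0 \<in> P" "1 \<notin> P"
    and "\<And>p q. p \<in> P \<Longrightarrow> q \<in> P \<Longrightarrow> p + q \<in> P"
    and l: "\<And>p q. p \<in> P \<Longrightarrow> q \<in> carrier (mpoly_ring V) \<Longrightarrow> q * p \<in> P"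
    and pr: "\<And>p q. p \<in> carrier (mpoly_ring V) \<Longrightarrow> q \<in> carrier (mpoly_ring V) \<Longrightarrow> p * q \<in> P \<Longrightarrow>
      p \<in> P \<or> q \<in> P"
  shows "primeideal P (mpoly_ring V)"
proof -
  interpret R: cring "mpoly_ring V :: ('v, 'a) mpoly ring" by (rule mpoly_ring_cring)
  have neg: "\<ominus>\<^bsub>mpoly_ring V\<^esub> p = - p" if "p \<in> carrier (mpoly_ring V)" for p :: "('v, 'a) mpoly"
    by (rule R.minus_equality) (use that in \<open>auto simp: mpoly_ring_simps\<close>)
  show ?thesis
  proof (rule primeidealI)
    show "ideal P (mpoly_ring V)"
    proof (rule idealI)
      show "subgroup P (add_monoid (mpoly_ring V))"
      proof (rule R.add.subgroupI)
        show "P \<subseteq> carrier (mpoly_ring V)" "P \<noteq> {}" using assms by auto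
      next
        fix p assume p: "p \<in> P"
        then show "\<ominus>\<^bsub>mpoly_ring V\<^esub> p \<in> P"
          using l[of p "- 1"] assms(1) neg[of p] by auto
      qed (use assms in \<open>auto simp: mpoly_ring_simps\<close>)
    next
      fix a x :: "('v, 'a) mpoly"
      assume "a \<in> P" "x \<in> carrier (mpoly_ring V)"
      then show "a \<otimes>\<^bsub>mpoly_ring V\<^esub> x \<in> P"
        using l[of a x] by (simp add: mpoly_ring_simps mult.commute)
    qed (use assms R.ring_axioms in \<open>auto simp: mpoly_ring_simps\<close>)
    show "carrier (mpoly_ring V) \<noteq> P" using assms(3) by auto
  qed (use R.cring_axioms pr in \<open>auto simp: mpoly_ring_simps\<close>)
qed

lemma kernel_primeideal:
  fixes f :: "('v, 'a::comm_ring_1) mpoly \<Rightarrow> 'b::idom"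
  assumes "comm_ring_hom f"
  shows "primeideal {p \<in> carrier (mpoly_ring V). f p = 0} (mpoly_ring V)"
proof -
  interpret comm_ring_hom f by fact
  show ?thesis
    by (rule primeideal_mpolyI) (auto simp: hom_add hom_mult)
qed

text \<open>The largest \<open>w\<close>-homogeneous ideal contained in \<open>P\<close>. Geometrically, it is the generic point of the orbit
  closure of \<open>P\<close> under the one-parameter group acting with weights \<open>w\<close>.\<close>

definition wcore :: "'v set \<Rightarrow> ('v \<Rightarrow> int) \<Rightarrow> ('v, 'a::comm_ring_1) mpoly set \<Rightarrow> ('v, 'a) mpoly set" where
  "wcore V w P = {p \<in> carrier (mpoly_ring V). \<forall>n. wcomp w n p \<in> P}"

context mpoly_prime
begin

lemma wcore_subset: "wcore V w P \<subseteq> P"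
proof
  fix p assume "p \<in> wcore V w P"
  then have "(\<Sum>n\<in>wdeg w ` Poly_Mapping.keys p. wcomp w n p) \<in> P"
    by (intro sum_mem) (auto simp: wcore_def)
  then show "p \<in> P" by (simp add: sum_wcomp)
qed

lemma wcomp_mem_wcore:
  assumes "p \<in> wcore V w P"
  shows "wcomp w n p \<in> wcore V w P"
  using assms by (auto simp: wcore_def wcomp_whomog[OF whomog_wcomp])

lemma whomog_mem_wcore:
  assumes "whomog w n p" "p \<in> P"
  shows "p \<in> wcore V w P"
  using assms by (auto simp: wcore_def wcomp_whomog mem_carrier)

lemma wcomp_mult:
  fixes p q :: "('v, 'a) mpoly"
  shows "wcomp w n (p * q) =
    (\<Sum>(i, j)\<in>wdeg w ` Poly_Mapping.keys p \<times> wdeg w ` Poly_Mapping.keys q.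
       if i + j = n then wcomp w i p * wcomp w j q else 0)"
proof -
  let ?A = "wdeg w ` Poly_Mapping.keys p" and ?B = "wdeg w ` Poly_Mapping.keys q"
  have "p * q = (\<Sum>i\<in>?A. wcomp w i p) * (\<Sum>j\<in>?B. wcomp w j q)"
    by (simp only: sum_wcomp)
  also have "\<dots> = (\<Sum>(i, j)\<in>?A \<times> ?B. wcomp w i p * wcomp w j q)"
    by (simp add: sum_product sum.cartesian_product)
  finally have "wcomp w n (p * q) = (\<Sum>(i, j)\<in>?A \<times> ?B. wcomp w n (wcomp w i p * wcomp w j q))"
    by (simp add: wcomp_sum case_prod_beta)
  also have "\<dots> = (\<Sum>(i, j)\<in>?A \<times> ?B. if i + j = n then wcomp w i p * wcomp w j q else 0)"
    by (intro sum.cong refl) (auto simp: wcomp_whomog[OF whomog_mult[OF whomog_wcomp whomog_wcomp]])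
  finally show ?thesis .
qed

lemma top_component:
  assumes "p \<in> carrier (mpoly_ring V)" "p \<notin> wcore V w P"
  obtains i where "i \<in> wdeg w ` Poly_Mapping.keys p" "wcomp w i p \<notin> P" "\<And>i'. i' > i \<Longrightarrow> wcomp w i' p \<in> P"
proof -
  let ?A = "{i \<in> wdeg w ` Poly_Mapping.keys p. wcomp w i p \<notin> P}"
  have supp: "wcomp w i p = 0" if "i \<notin> wdeg w ` Poly_Mapping.keys p" for i
    using that by (intro poly_mapping_eqI) (auto simp: lookup_wcomp in_keys_iff)
  have fin: "finite ?A" by simp
  have ne: "?A \<noteq> {}"
    using assms supp by (fastforce simp: wcore_def)
  show thesis
  proof (rule that[of "Max ?A"])
    show "Max ?A \<in> wdeg w ` Poly_Mapping.keys p" "wcomp w (Max ?A) p \<notin> P"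
      using Max_in[OF fin ne] by auto
    show "wcomp w i' p \<in> P" if "i' > Max ?A" for i'
    proof (rule ccontr)
      assume "wcomp w i' p \<notin> P"
      then have "i' \<in> ?A" using supp by fastforce
      then show False using Max_ge[OF fin] that by fastforce
    qed
  qed
qed

text \<open>A leading term argument, possible because the degrees are totally ordered: the highest
  components outside \<open>P\<close> of two elements not in the core multiply, modulo
  \<open>P\<close>, to a component of the product.\<close>

lemma wcore_primeideal: "primeideal (wcore V w P) (mpoly_ring V)"
proof (rule primeideal_mpolyI)
  show "wcore V w P \<subseteq> carrier (mpoly_ring V)" "0 \<in> wcore V w P"
    by (auto simp: wcore_def)
  show "1 \<notin> wcore V w P" using wcore_subset one_notin by blast
next
  fix p q assume "p \<in> wcore V w P" "q \<in> wcore V w P"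
  then show "p + q \<in> wcore V w P" by (auto simp: wcore_def wcomp_add intro: add_mem)
next
  fix p q :: "('v, 'a) mpoly"
  assume p: "p \<in> wcore V w P" and q: "q \<in> carrier (mpoly_ring V)"
  then show "q * p \<in> wcore V w P"
    unfolding wcore_def by (auto simp: wcomp_mult intro!: sum_mem mult_mem_left)
next
  fix p q
  assume p: "p \<in> carrier (mpoly_ring V)" and q: "q \<in> carrier (mpoly_ring V)" and pq: "p * q \<in> wcore V w P"
  show "p \<in> wcore V w P \<or> q \<in> wcore V w P"
  proof (rule ccontr)
    assume "\<not> ?thesis"
    then have "p \<notin> wcore V w P" and "q \<notin> wcore V w P" by auto
    obtain i where i: "i \<in> wdeg w ` Poly_Mapping.keys p" "wcomp w i p \<notin> P"
      "\<And>i'. i' > i \<Longrightarrow> wcomp w i' p \<in> P"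
      using top_component[OF p \<open>p \<notin> _\<close>] by metis
    obtain j where j: "j \<in> wdeg w ` Poly_Mapping.keys q" "wcomp w j q \<notin> P"
      "\<And>j'. j' > j \<Longrightarrow> wcomp w j' q \<in> P"
      using top_component[OF q \<open>q \<notin> _\<close>] by metis
    have "wcomp w (i + j) (p * q) \<in> P" using pq by (simp add: wcore_def)
    then have "(case (i, j) of (i', j') \<Rightarrow> if i' + j' = i + j then wcomp w i' p * wcomp w j' q else 0) \<in> P"
      unfolding wcomp_mult
    proof (subst (asm) sum_mem_iff)
      fix y assume y: "y \<noteq> (i, j)"
      obtain a b where ab: "y = (a, b)" by force
      \<comment> \<open>A pair of the same total degree other than \<open>(i, j)\<close> exceeds it
        in one entry, and components above the top ones lie in \<open>P\<close>.\<close>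
      consider "a + b \<noteq> i + j" | "a > i" | "b > j" using y ab by force
      then show "(case y of (i', j') \<Rightarrow> if i' + j' = i + j then wcomp w i' p * wcomp w j' q else 0) \<in> P"
        by cases (auto simp: ab p q intro: mult_mem_left mult_mem_right i(3) j(3))
    qed (use i j in auto)
    then show False
      using prime_mem[of "wcomp w i p" "wcomp w j q"] i(2) j(2) p q by auto
  qed
qed

lemma wcore_one_proj_point:
  assumes "\<not> mp_var ` V \<subseteq> P"
  shows "wcore V (\<lambda>_. 1) P \<in> proj_points V"
  unfolding proj_points_def
proof (intro CollectI conjI ballI allI)
  fix p e assume "p \<in> wcore V (\<lambda>_. 1) P"
  then show "hom_part e p \<in> wcore V (\<lambda>_. 1) P"
    by (simp add: hom_part_eq_wcomp wcomp_mem_wcore)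
qed (use assms wcore_primeideal wcore_subset in blast)+

end

lemma proj_pointD:
  assumes "P \<in> proj_points V"
  shows "mpoly_prime V P" "\<And>p e. p \<in> P \<Longrightarrow> hom_part e p \<in> P" "\<not> mp_var ` V \<subseteq> P"
  using assms by (auto simp: proj_points_def mpoly_prime_def)

text \<open>The \<open>w\<close>-grading commutes with the standard one, so the core of a
  homogeneous ideal stays homogeneous in the standard sense.\<close>

lemma wcore_proj_point:
  assumes "P \<in> proj_points V"
  shows "wcore V w P \<in> proj_points V"
proof -
  interpret mpoly_prime V P using assms by (rule proj_pointD)
  show ?thesis
    unfolding proj_points_def
  proof (intro CollectI conjI ballI allI)
    fix p e assume p: "p \<in> wcore V w P"
    then have "hom_part e (wcomp w n p) \<in> P" for n
      using proj_pointD(2)[OF assms] by (auto simp: wcore_def)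
    then show "hom_part e p \<in> wcore V w P"
      using p by (simp add: wcore_def hom_part_eq_wcomp wcomp_commute[of _ _ "\<lambda>_. 1"])
  qed (use proj_pointD(3)[OF assms] wcore_primeideal wcore_subset in blast)+
qed

text \<open>Open sets are stable under generization: a set of polynomials not contained in
  \<open>P\<close> is not contained in the smaller \<open>R\<close>. For a clopen set this applies
  to the complement as well.\<close>

lemma clopen_zariski_generization:
  assumes "openin (subtopology (zariski V) Z) T" "closedin (subtopology (zariski V) Z) T"
    and Z: "Z \<subseteq> proj_points V" "P \<in> Z" "R \<in> Z" "R \<subseteq> P"
  shows "P \<in> T \<longleftrightarrow> R \<in> T"
proof -
  have gen: "R \<in> U" if U: "openin (subtopology (zariski V) Z) U" "P \<in> U" for U
  proof -
    obtain S where "U = (proj_points V - proj_closed V S) \<inter> Z"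
      using U(1) unfolding openin_subtopology openin_zariski by blast
    then show ?thesis using U(2) Z by (auto simp: proj_closed_def)
  qed
  have top: "topspace (subtopology (zariski V) Z) = Z"
    using Z(1) by (auto simp: topspace_zariski)
  have "openin (subtopology (zariski V) Z) (Z - T)"
    using assms(2) unfolding closedin_def top by blast
  then show ?thesis
    using gen[OF assms(1)] gen[of "Z - T"] Z by blast
qed

section \<open>Minors and the Pluecker ideal\<close>

text \<open>The matrix is a function on row-column pairs, so that one \<open>M\<close> serves all
  tuples of columns and ring homomorphisms act entrywise.\<close>

definition minor :: "nat \<Rightarrow> (nat \<times> 'c \<Rightarrow> 'b) \<Rightarrow> 'c list \<Rightarrow> 'b::comm_ring_1" where
  "minor k M t = det (mat (Suc k) (Suc k) (\<lambda>(a, b). M (a, t ! b)))"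

lemma generic_minor_eq: "generic_minor k t = minor k mp_var t"
  by (simp add: generic_minor_def minor_def)

lemma hom_minor:
  assumes "comm_ring_hom h"
  shows "h (minor k M t) = minor k (\<lambda>x. h (M x)) t"
proof -
  interpret comm_ring_hom h by fact
  show ?thesis
    unfolding minor_def hom_det[symmetric]
    by (intro arg_cong[where f = det] eq_matI) auto
qed

lemma mp_subst_generic_minor:
  "comm_ring_hom h \<Longrightarrow> mp_subst h M (generic_minor k t) = minor k M t"
  by (simp add: generic_minor_eq hom_minor[OF comm_ring_hom_mp_subst])

text \<open>The torus weight of the Pluecker coordinate of \<open>t\<close> when the coordinate
  \<open>x_c\<close> has weight \<open>w c\<close>.\<close>

definition tuple_weight :: "nat \<Rightarrow> ('c \<Rightarrow> int) \<Rightarrow> 'c list \<Rightarrow> int" where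
  "tuple_weight k w t = (\<Sum>b<Suc k. w (t ! b))"

text \<open>Each Leibniz term uses every row and every column once, so its weight does not depend on
  the permutation.\<close>

lemma whomog_generic_minor:
  fixes t :: "'b list"
  shows "whomog (\<lambda>(a, c). u a + w c) ((\<Sum>a<Suc k. u a) + tuple_weight k w t)
    (generic_minor k t :: (nat \<times> 'b, 'c::comm_ring_1) mpoly)"
proof -
  have H1: "whomog (\<lambda>(a, c). u a + w c) (0 + (\<Sum>a = 0..<Suc k. u a + w (t ! q a)))
      (of_int (sign q) * (\<Prod>a = 0..<Suc k. mp_var (a, t ! q a) :: (nat \<times> 'b, 'c) mpoly))"
    for q
    by (intro whomog_mult whomog_of_int whomog_prod)
      (use whomog_var[of "\<lambda>(a, c). u a + w c"] in force)
  have H2: "(\<Sum>a = 0..<Suc k. u a + w (t ! q a)) = (\<Sum>a<Suc k. u a) + tuple_weight k w t"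
    if "q permutes {0..<Suc k}" for q
    using sum.permute[OF that, of "\<lambda>b. w (t ! b)"]
    by (simp add: tuple_weight_def sum.distrib atLeast0LessThan o_def)
  have hom: "whomog (\<lambda>(a, c). u a + w c) ((\<Sum>a<Suc k. u a) + tuple_weight k w t)
      (of_int (sign q) * (\<Prod>a = 0..<Suc k. mp_var (a, t ! q a) :: (nat \<times> 'b, 'c) mpoly))"
    if "q permutes {0..<Suc k}" for q
    using H1[of q] unfolding H2[OF that] by (simp only: add_0)
  let ?A = "mat (Suc k) (Suc k) (\<lambda>(a, b). mp_var (a, t ! b) :: (nat \<times> 'b, 'c) mpoly)"
  have entries: "(\<Prod>a = 0..<Suc k. ?A $$ (a, q a)) = (\<Prod>a = 0..<Suc k. mp_var (a, t ! q a))"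
    if "q permutes {0..<Suc k}" for q
  proof (intro prod.cong refl)
    fix a assume "a \<in> {0..<Suc k}"
    then have "a < Suc k" "q a < Suc k" using permutes_in_image[OF that, of a] by auto
    then show "?A $$ (a, q a) = mp_var (a, t ! q a)" by simp
  qed
  have "generic_minor k t =
      (\<Sum>q | q permutes {0..<Suc k}. of_int (sign q) * (\<Prod>a = 0..<Suc k. ?A $$ (a, q a)))"
    unfolding generic_minor_def by (rule det_def') simp
  also have "\<dots> = (\<Sum>q | q permutes {0..<Suc k}.
      of_int (sign q) * (\<Prod>a = 0..<Suc k. mp_var (a, t ! q a)))"
    by (intro sum.cong refl arg_cong2[where f = "(*)"] entries) auto
  finally show ?thesis
    by (simp only:) (intro whomog_sum hom, simp)
qed

text \<open>Weight \<open>e\<close> on a single row of the generic matrix adds \<open>e\<close> to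
  every minor. Thus \<open>e = 1\<close>, \<open>w = 0\<close> is the standard grading and
  \<open>e = 0\<close> the torus grading.\<close>

lemma wcomp_plucker_ideal:
  fixes p :: "('c list, 'a::comm_ring_1) mpoly"
  assumes "p \<in> plucker_ideal C k"
  shows "wcomp (\<lambda>t. e + tuple_weight k w t) n p \<in> plucker_ideal C k"
proof -
  have e: "(\<Sum>a<Suc k. if a = 0 then e else 0) = e" by simp
  have "whomog (\<lambda>(a, c). (if a = 0 then e else 0) + w c) (e + tuple_weight k w t)
      (generic_minor k t :: (nat \<times> 'c, 'a) mpoly)" for t
    using whomog_generic_minor[of "\<lambda>a. if a = 0 then e else 0" w k t] unfolding e .
  from wcomp_mp_subst[where g = "generic_minor k" and w = "\<lambda>t. e + tuple_weight k w t" and p = p and n = n, OF this] show ?thesis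
    using assms by (auto simp: plucker_ideal_def)
qed

lemma minor_zero_column:
  assumes "b < Suc k" "\<And>a. a < Suc k \<Longrightarrow> M (a, t ! b) = 0"
  shows "minor k M t = 0"
  unfolding minor_def
  by (subst laplace_expansion_column[of _ "Suc k" b]) (use assms in \<open>auto intro!: sum.neutral\<close>)

lemma minor_not_distinct:
  assumes "\<not> distinct t" "length t = Suc k"
  shows "minor k M t = 0"
proof -
  obtain i j where "i < Suc k" "j < Suc k" "i \<noteq> j" "t ! i = t ! j"
    using assms by (auto simp: distinct_conv_nth)
  then show ?thesis
    unfolding minor_def by (intro det_identical_columns[of _ "Suc k" i j]) (auto intro!: eq_vecI)
qed

definition coord_mat :: "'c list \<Rightarrow> nat \<times> 'c \<Rightarrow> 'b::comm_ring_1" where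
  "coord_mat t = (\<lambda>(a, c). if t ! a = c then 1 else 0)"

lemma minor_coord_mat_self:
  assumes "distinct t" "length t = Suc k"
  shows "minor k (coord_mat t) t = 1"
proof -
  have "mat (Suc k) (Suc k) (\<lambda>(a, b). coord_mat t (a, t ! b)) = (1\<^sub>m (Suc k) :: 'b mat)"
    using assms by (intro eq_matI) (auto simp: coord_mat_def nth_eq_iff_index_eq)
  then show ?thesis unfolding minor_def by simp
qed

lemma minor_coord_mat_eq_0:
  assumes "length s = Suc k" "length t = Suc k" "\<not> set s \<subseteq> set t"
  shows "minor k (coord_mat t) s = 0"
proof -
  obtain c where "c \<in> set s" "c \<notin> set t"
    using assms(3) by blast
  then obtain b where "b < Suc k" "s ! b \<notin> set t"
    using assms(1) by (metis in_set_conv_nth)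
  moreover from this have "t ! a \<noteq> s ! b" if "a < Suc k" for a
    using that assms(2) nth_mem by metis
  ultimately show ?thesis
    by (intro minor_zero_column[of b]) (auto simp: coord_mat_def)
qed

text \<open>The columns \<open>s\<close> of \<open>M\<close> arise from the columns \<open>t\<close>
  by multiplication with a 0/1 selection matrix, and determinants multiply.\<close>

lemma minor_subset:
  assumes t: "distinct t" "length t = Suc k" and s: "length s = Suc k" "set s \<subseteq> set t"
  shows "minor k M s = minor k (coord_mat t) s * minor k M t"
proof -
  let ?M = "mat (Suc k) (Suc k) (\<lambda>(a, b). M (a, t ! b))"
  let ?E = "mat (Suc k) (Suc k) (\<lambda>(a, b). coord_mat t (a, s ! b))"
  have "mat (Suc k) (Suc k) (\<lambda>(a, b). M (a, s ! b)) = ?M * ?E"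
  proof (rule eq_matI)
    fix i b assume "i < dim_row (?M * ?E)" "b < dim_col (?M * ?E)"
    then have ib: "i < Suc k" "b < Suc k" by auto
    then obtain j where j: "j < Suc k" "t ! j = s ! b"
      using s t by (metis in_set_conv_nth nth_mem subset_iff)
    have "(?M * ?E) $$ (i, b) = (\<Sum>a = 0..<Suc k. M (i, t ! a) * coord_mat t (a, s ! b))"
      using ib by (simp add: scalar_prod_def del: sum.op_ivl_Suc)
    also have "\<dots> = (\<Sum>a = 0..<Suc k. if a = j then M (i, s ! b) else 0)"
    proof (intro sum.cong refl)
      fix a assume "a \<in> {0..<Suc k}"
      then have "t ! a = s ! b \<longleftrightarrow> a = j" using j t nth_eq_iff_index_eq[of t a j] by auto
      then show "M (i, t ! a) * coord_mat t (a, s ! b) = (if a = j then M (i, s ! b) else 0)"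
        by (auto simp: coord_mat_def)
    qed
    also have "\<dots> = M (i, s ! b)" using j by (simp del: sum.op_ivl_Suc)
    finally show "mat (Suc k) (Suc k) (\<lambda>(a, b). M (a, s ! b)) $$ (i, b) = (?M * ?E) $$ (i, b)"
      using ib by simp
  qed auto
  moreover have "det (?M * ?E) = det ?M * det ?E" by (rule det_mult) auto
  ultimately show ?thesis unfolding minor_def by (simp add: mult.commute)
qed

lemma minor_list_update:
  assumes "length t = Suc k" "a < Suc k"
  shows "minor k M (t[a := c]) =
    (\<Sum>l<Suc k. M (l, c) * cofactor (mat (Suc k) (Suc k) (\<lambda>(i, b). M (i, t ! b))) l a)"
proof -
  let ?A = "mat (Suc k) (Suc k) (\<lambda>(i, b). M (i, t ! b))"
  let ?B = "mat (Suc k) (Suc k) (\<lambda>(l, b). M (l, t[a := c] ! b))"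
  have "minor k M (t[a := c]) = (\<Sum>l<Suc k. ?B $$ (l, a) * cofactor ?B l a)"
    unfolding minor_def by (rule laplace_expansion_column) (use assms(2) in auto)
  also have "\<dots> = (\<Sum>l<Suc k. M (l, c) * cofactor ?A l a)"
  proof (intro sum.cong refl)
    fix l assume "l \<in> {..<Suc k}"
    moreover have "mat_delete ?B l a = mat_delete ?A l a"
      using assms by (intro eq_matI) (auto simp: mat_delete_def nth_list_update)
    ultimately show "?B $$ (l, a) * cofactor ?B l a = M (l, c) * cofactor ?A l a"
      using assms by (simp add: cofactor_def)
  qed
  finally show ?thesis .
qed

text \<open>With \<open>A\<close> the square submatrix on \<open>t\<close>, this is the
  \<open>(i, c)\<close> entry of \<open>det(A) M = A adj(A) M\<close>.\<close>

lemma minor_cramer: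
  assumes "length t = Suc k" "i < Suc k"
  shows "minor k M t * M (i, c) = (\<Sum>a<Suc k. minor k M (t[a := c]) * M (i, t ! a))"
proof -
  let ?n = "Suc k"
  let ?A = "mat ?n ?n (\<lambda>(a, b). M (a, t ! b))"
  have A: "?A \<in> carrier_mat ?n ?n" by simp
  have min: "minor k M (t[a := c]) = (\<Sum>l<?n. M (l, c) * cofactor ?A l a)" if "a < ?n" for a
    using assms(1) that by (rule minor_list_update)
  have adj: "(\<Sum>a<?n. M (i, t ! a) * cofactor ?A l a) = (if i = l then minor k M t else 0)"
    if l: "l < ?n" for l
  proof -
    have "(?A * adj_mat ?A) $$ (i, l) = (\<Sum>a<?n. M (i, t ! a) * cofactor ?A l a)"
      using assms(2) l by (auto simp: adj_mat_def scalar_prod_def atLeast0LessThan intro!: sum.cong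
        simp del: sum.op_ivl_Suc sum.lessThan_Suc)
    moreover have "(?A * adj_mat ?A) $$ (i, l) = (if i = l then minor k M t else 0)"
      unfolding adj_mat(2)[OF A] minor_def using assms(2) l by auto
    ultimately show ?thesis by simp
  qed
  have "(\<Sum>a<?n. minor k M (t[a := c]) * M (i, t ! a)) =
      (\<Sum>a<?n. \<Sum>l<?n. M (l, c) * (M (i, t ! a) * cofactor ?A l a))"
    by (intro sum.cong refl) (simp add: min sum_distrib_left ac_simps del: sum.lessThan_Suc)
  also have "\<dots> = (\<Sum>l<?n. M (l, c) * (\<Sum>a<?n. M (i, t ! a) * cofactor ?A l a))"
    by (subst sum.swap) (simp add: sum_distrib_left del: sum.lessThan_Suc)
  also have "\<dots> = (\<Sum>l<?n. if i = l then M (l, c) * minor k M t else 0)"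
    by (intro sum.cong refl) (use adj in auto)
  also have "\<dots> = minor k M t * M (i, c)"
    using assms(2) by (simp add: mult.commute del: sum.lessThan_Suc)
  finally show ?thesis by simp
qed

text \<open>The classical one-column Pluecker relation: expand the second minor along column
  \<open>b\<close> and rewrite its entries by Cramer's rule for \<open>t\<close>.\<close>

lemma minor_exchange:
  assumes t: "length t = Suc k" and s: "length s = Suc k" and b: "b < Suc k"
  shows "minor k M t * minor k M s = (\<Sum>a<Suc k. minor k M (t[a := s ! b]) * minor k M (s[b := t ! a]))"
proof -
  let ?n = "Suc k"
  let ?S = "mat ?n ?n (\<lambda>(i, j). M (i, s ! j))"
  have exp: "minor k M (s[b := c]) = (\<Sum>i<?n. M (i, c) * cofactor ?S i b)" for c
    using s b by (rule minor_list_update)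
  have "minor k M t * minor k M s = (\<Sum>i<?n. (minor k M t * M (i, s ! b)) * cofactor ?S i b)"
    using exp[of "s ! b"] by (simp add: sum_distrib_left mult.assoc del: sum.lessThan_Suc)
  also have "\<dots> = (\<Sum>i<?n. (\<Sum>a<?n. minor k M (t[a := s ! b]) * M (i, t ! a)) * cofactor ?S i b)"
    by (intro sum.cong refl) (simp add: minor_cramer[OF t] del: sum.lessThan_Suc)
  also have "\<dots> = (\<Sum>i<?n. \<Sum>a<?n. minor k M (t[a := s ! b]) * (M (i, t ! a) * cofactor ?S i b))"
    by (simp add: sum_distrib_right mult.assoc del: sum.lessThan_Suc)
  also have "\<dots> = (\<Sum>a<?n. minor k M (t[a := s ! b]) * minor k M (s[b := t ! a]))"
    by (subst sum.swap) (simp add: exp sum_distrib_left del: sum.lessThan_Suc)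
  finally show ?thesis .
qed

lemma plucker_not_distinct:
  assumes "t \<in> plucker_index C k" "\<not> distinct t"
  shows "mp_var t \<in> plucker_ideal C k"
  using assms minor_not_distinct[of t k "mp_var"]
  by (auto simp: plucker_ideal_def plucker_index_def generic_minor_eq comm_ring_hom_mp_const)

text \<open>The scalar is a sign if \<open>s\<close> rearranges \<open>t\<close> and zero if
  \<open>s\<close> has repetitions; so a single coordinate determines all those supported on
  \<open>set t\<close>.\<close>

lemma plucker_subset:
  fixes s t :: "'c list"
  assumes t: "t \<in> plucker_index C k" "distinct t" and s: "s \<in> plucker_index C k" "set s \<subseteq> set t"
  shows "mp_var s - mp_const (minor k (coord_mat t) s) * mp_var t
    \<in> (plucker_ideal C k :: ('c list, 'a::comm_ring_1) mpoly set)"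
proof -
  note c = comm_ring_hom_mp_const
  interpret h: comm_ring_hom "mp_subst mp_const (generic_minor k)"
    by (rule comm_ring_hom_mp_subst[OF c])
  have "(\<lambda>x. mp_const (coord_mat t x)) = (coord_mat t :: nat \<times> 'c \<Rightarrow> (nat \<times> 'c, 'a) mpoly)"
    by (auto simp: coord_mat_def mp_const_def)
  then have m: "mp_const (minor k (coord_mat t) s) = (minor k (coord_mat t) s :: (nat \<times> 'c, 'a) mpoly)"
    by (simp add: hom_minor[OF c])
  have "mp_const (minor k (coord_mat t) s) * generic_minor k t =
      (generic_minor k s :: (nat \<times> 'c, 'a) mpoly)"
    using minor_subset[of t k s "mp_var :: nat \<times> 'c \<Rightarrow> (nat \<times> 'c, 'a) mpoly"] t s
    by (simp add: m generic_minor_eq plucker_index_def)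
  then show ?thesis
    using t s by (auto simp: plucker_ideal_def h.hom_minus h.hom_mult c)
qed

lemma plucker_exchange:
  assumes t: "t \<in> plucker_index C k" and s: "s \<in> plucker_index C k" and b: "b < Suc k"
  shows "mp_var t * mp_var s - (\<Sum>a<Suc k. mp_var (t[a := s ! b]) * mp_var (s[b := t ! a]))
    \<in> plucker_ideal C k"
proof -
  note c = comm_ring_hom_mp_const
  interpret h: comm_ring_hom "mp_subst mp_const (generic_minor k)"
    by (rule comm_ring_hom_mp_subst[OF c])
  have idx: "t[a := s ! b] \<in> plucker_index C k" "s[b := t ! a] \<in> plucker_index C k" if "a < Suc k" for a
    using t s b that set_update_subset_insert[of t a "s ! b"] set_update_subset_insert[of s b "t ! a"]
    by (auto simp: plucker_index_def dest!: subsetD[OF set_update_subset_insert])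
  have "mp_subst mp_const (generic_minor k) (mp_var t * mp_var s -
      (\<Sum>a<Suc k. mp_var (t[a := s ! b]) * mp_var (s[b := t ! a]))) = 0"
    using minor_exchange[of t k s b mp_var] t s b
    by (simp add: h.hom_minus h.hom_mult h.hom_sum c generic_minor_eq plucker_index_def
      del: sum.lessThan_Suc)
  then show ?thesis
    using t s idx unfolding plucker_ideal_def by (auto intro!: mpoly_diff_closed mpoly_sum_closed
      simp del: sum.lessThan_Suc)
qed

section \<open>The equations of the Fano scheme\<close>

text \<open>The monomial obtained by expanding a product of \<open>d\<close> linear forms in \<open>s\<^sub>0, \<dots>, s\<^sub>k\<close> and choosing
  the variable with index \<open>g j\<close> from the \<open>j\<close>-th factor.\<close>

definition choice_monomial :: "nat \<Rightarrow> (nat \<Rightarrow> nat) \<Rightarrow> nat \<Rightarrow>\<^sub>0 nat" where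
  "choice_monomial d g = (\<Sum>j<d. Poly_Mapping.single (g j) 1)"

lemma wdeg_choice_monomial: "wdeg u (choice_monomial d g) = (\<Sum>j<d. u (g j))"
  by (simp add: choice_monomial_def wdeg_sum)

lemma lookup_choice_monomial: "Poly_Mapping.lookup (choice_monomial d g) a = card {j. j < d \<and> g j = a}"
proof -
  have "Poly_Mapping.lookup (choice_monomial d g) a = (\<Sum>j<d. if g j = a then 1 else 0)"
    by (auto simp: choice_monomial_def lookup_sum lookup_single when_def intro!: sum.cong)
  also have "\<dots> = card {j. j < d \<and> g j = a}"
    by (subst sum.inter_filter[symmetric]) (auto intro: arg_cong[where f = card])
  finally show ?thesis .
qed

lemma choice_monomial_eq_image:
  assumes "choice_monomial d g = choice_monomial d g'"
  shows "g ` {..<d} = g' ` {..<d}"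
proof -
  have "g ` {..<d} = {a. Poly_Mapping.lookup (choice_monomial d g) a \<noteq> 0}" for g
    by (auto simp: lookup_choice_monomial)
  then show ?thesis using assms by simp
qed

lemma choice_monomial_cancel:
  assumes "choice_monomial d g = choice_monomial d g'" "i < d"
    and "\<And>j. j < d \<Longrightarrow> j \<noteq> i \<Longrightarrow> g j = g' j"
  shows "g i = g' i"
proof -
  have *: "choice_monomial d g = Poly_Mapping.single (g i) 1 + (\<Sum>j\<in>{..<d} - {i}. Poly_Mapping.single (g j) 1)"
    for g using assms(2) by (simp add: choice_monomial_def sum.remove)
  have "(\<Sum>j\<in>{..<d} - {i}. Poly_Mapping.single (g j) 1) =
      (\<Sum>j\<in>{..<d} - {i}. Poly_Mapping.single (g' j) (1 :: nat))"
    using assms(3) by (intro sum.cong) auto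
  then have "Poly_Mapping.single (g i) (1 :: nat) = Poly_Mapping.single (g' i) 1"
    using assms(1) *[of g] *[of g'] by simp
  then show ?thesis
    by (metis keys_single singleton_inject zero_neq_one)
qed

text \<open>The coefficient of \<open>s_a\<close> in the pullback of \<open>x_ij\<close> is the
  coordinate of \<open>t[a := (i, j)]\<close>. When the product of row \<open>i\<close> is expanded,
  \<open>g\<close> records which parameter is picked from each factor; the choices yielding the
  monomial \<open>m\<close> are collected.\<close>

definition fano_coeff ::
    "nat \<Rightarrow> nat \<Rightarrow> nat \<Rightarrow> (nat \<times> nat) list \<Rightarrow> (nat \<Rightarrow>\<^sub>0 nat) \<Rightarrow> ((nat \<times> nat) list, 'a::comm_ring_1) mpoly"
  where
  "fano_coeff r d k t m = (\<Sum>(i, g)\<in>{..<r} \<times> ({..<d} \<rightarrow>\<^sub>E {..k}).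
     if choice_monomial d g = m then \<Prod>j<d. mp_var (t[g j := (i, j)]) else 0)"

lemma prod_single:
  "(\<Prod>x\<in>A. Poly_Mapping.single (f x) (c x)) =
    Poly_Mapping.single (\<Sum>x\<in>A. f x) (\<Prod>x\<in>A. c x :: 'a::comm_ring_1)"
  for f :: "'b \<Rightarrow> 'c::comm_monoid_add"
  by (induction A rule: infinite_finite_induct) (simp_all add: mult_single)

lemma lookup_pullback_X_form:
  "Poly_Mapping.lookup (mp_subst (\<lambda>b. mp_const (mp_const b)) (universal_point k t) (X_form r d)) m =
    (fano_coeff r d k t m :: ((nat \<times> nat) list, 'a::comm_ring_1) mpoly)"
proof -
  let ?h = "\<lambda>b. mp_const (mp_const b) :: (nat, ((nat \<times> nat) list, 'a) mpoly) mpoly"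
  let ?q = "\<lambda>i j a. mp_var (t[a := (i, j)]) :: ((nat \<times> nat) list, 'a) mpoly"
  have c: "comm_ring_hom ?h"
    by (rule comm_ring_hom_comp[OF comm_ring_hom_mp_const comm_ring_hom_mp_const])
  interpret h: comm_ring_hom "mp_subst ?h (universal_point k t)"
    by (rule comm_ring_hom_mp_subst[OF c])
  have var_const: "mp_var a * mp_const q = Poly_Mapping.single (Poly_Mapping.single a 1) q"
    for a :: nat and q :: "((nat \<times> nat) list, 'a) mpoly"
    by (simp add: mp_var_def mp_const_def mult_single)
  have "mp_subst ?h (universal_point k t) (X_form r d) =
      (\<Sum>i<r. \<Prod>j<d. \<Sum>a\<le>k. Poly_Mapping.single (Poly_Mapping.single a 1) (?q i j a))"
    unfolding X_form_def h.hom_sum h.hom_prod mp_subst_var[OF c] universal_point_def var_const ..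
  also have "\<dots> = (\<Sum>i<r. \<Sum>g\<in>{..<d} \<rightarrow>\<^sub>E {..k}.
      Poly_Mapping.single (choice_monomial d g) (\<Prod>j<d. ?q i j (g j)))"
    by (simp add: prod_sum_PiE prod_single choice_monomial_def)
  also have "\<dots> = (\<Sum>(i, g)\<in>{..<r} \<times> ({..<d} \<rightarrow>\<^sub>E {..k}).
      Poly_Mapping.single (choice_monomial d g) (\<Prod>j<d. ?q i j (g j)))"
    by (rule sum.cartesian_product)
  finally show ?thesis
    by (simp add: fano_coeff_def lookup_sum lookup_single when_def case_prod_beta)
qed

lemma list_update_plucker_index:
  "t \<in> plucker_index C k \<Longrightarrow> c \<in> C \<Longrightarrow> t[a := c] \<in> plucker_index C k"
  using set_update_subset_insert[of t a c] by (auto simp: plucker_index_def)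

lemma tuple_weight_update:
  assumes "length t = Suc k" "a \<le> k"
  shows "tuple_weight k w (t[a := c]) = tuple_weight k w t - w (t ! a) + w c"
proof -
  have *: "tuple_weight k w s = w (s ! a) + (\<Sum>b\<in>{..<Suc k} - {a}. w (s ! b))" for s
    unfolding tuple_weight_def using assms(2) by (intro sum.remove) auto
  have "(\<Sum>b\<in>{..<Suc k} - {a}. w (t[a := c] ! b)) = (\<Sum>b\<in>{..<Suc k} - {a}. w (t ! b))"
    by (intro sum.cong) auto
  then show ?thesis
    using assms *[of t] *[of "t[a := c]"] by simp
qed

lemma tuple_weight_distinct:
  assumes "length t = Suc k" "distinct t"
  shows "tuple_weight k w t = sum w (set t)"
proof -
  have "tuple_weight k w t = (\<Sum>b<length t. w (t ! b))"
    using assms(1) by (simp add: tuple_weight_def)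
  also have "\<dots> = sum_list (map w t)"
    by (simp add: sum_list_sum_nth atLeast0LessThan)
  finally show ?thesis using assms(2) by (simp add: sum_list_distinct_conv_sum_set)
qed

text \<open>Replacing \<open>t ! g j\<close> by \<open>(i, j)\<close> changes the weight by
  \<open>w (i, j) - w (t ! g j)\<close>. Over all \<open>j\<close> the first parts cancel and the
  second depend only on the monomial, so terms from different rows have the same weight.\<close>

lemma whomog_fano_coeff:
  assumes w: "\<And>i. i < r \<Longrightarrow> (\<Sum>j<d. w (i, j)) = 0" and t: "length t = Suc k"
  shows "whomog (\<lambda>s. e + tuple_weight k w s)
    (int d * (e + tuple_weight k w t) - wdeg (\<lambda>a. w (t ! a)) m)
    (fano_coeff r d k t m :: (_, 'a::comm_ring_1) mpoly)"
proof -
  have hom: "whomog (\<lambda>s. e + tuple_weight k w s)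
    (int d * (e + tuple_weight k w t) - wdeg (\<lambda>a. w (t ! a)) m)
    (if choice_monomial d g = m then \<Prod>j<d. mp_var (t[g j := (i, j)]) else 0 :: (_, 'a) mpoly)"
    if i: "i \<in> {..<r}" and g: "g \<in> {..<d} \<rightarrow>\<^sub>E {..k}" for i g
  proof -
  have "whomog (\<lambda>s. e + tuple_weight k w s) (\<Sum>j<d. e + tuple_weight k w (t[g j := (i, j)]))
      (\<Prod>j<d. mp_var (t[g j := (i, j)]) :: (_, 'a) mpoly)"
  proof (rule whomog_prod)
    show "whomog (\<lambda>s. e + tuple_weight k w s) (e + tuple_weight k w (t[g j := (i, j)]))
        (mp_var (t[g j := (i, j)]) :: (_, 'a) mpoly)" for j
      by (rule whomog_var[of "\<lambda>s. e + tuple_weight k w s"])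
  qed
  also have "(\<Sum>j<d. e + tuple_weight k w (t[g j := (i, j)])) =
      (\<Sum>j<d. e + tuple_weight k w t - w (t ! g j) + w (i, j))"
  proof (rule sum.cong[OF refl])
    fix j assume "j \<in> {..<d}"
    then have "g j \<le> k" using g by auto
    then show "e + tuple_weight k w (t[g j := (i, j)]) = e + tuple_weight k w t - w (t ! g j) + w (i, j)"
      by (simp add: tuple_weight_update[OF t])
  qed
  also have "\<dots> = int d * (e + tuple_weight k w t) - wdeg (\<lambda>a. w (t ! a)) (choice_monomial d g)"
    using i w[of i] by (simp add: sum.distrib sum_subtractf wdeg_choice_monomial)
  finally show ?thesis by auto
  qed
  show ?thesis
    unfolding fano_coeff_def
    unfolding case_prod_beta
  proof (rule whomog_sum)
    fix x assume "x \<in> {..<r} \<times> ({..<d} \<rightarrow>\<^sub>E {..k})"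
    then show "whomog (\<lambda>s. e + tuple_weight k w s)
      (int d * (e + tuple_weight k w t) - wdeg (\<lambda>a. w (t ! a)) m)
      (if choice_monomial d (snd x) = m then \<Prod>j<d. mp_var (t[snd x j := (fst x, j)])
        else 0 :: (_, 'a) mpoly)"
      by (intro hom) (simp_all add: mem_Times_iff)
  qed
qed

lemma fano_coeff_closed:
  assumes "t \<in> plucker_index (X_coords r d) k"
  shows "(fano_coeff r d k t m :: (_, 'a::comm_ring_1) mpoly) \<in> carrier (mpoly_ring (plucker_index (X_coords r d) k))"
  unfolding fano_coeff_def case_prod_beta
proof (rule mpoly_sum_closed)
  fix x assume "x \<in> {..<r} \<times> ({..<d} \<rightarrow>\<^sub>E {..k})"
  then have "fst x < r" by (simp add: mem_Times_iff)
  then have "(mp_var (t[snd x j := (fst x, j)]) :: (_, 'a) mpoly) \<in> carrier (mpoly_ring (plucker_index (X_coords r d) k))"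
    if "j < d" for j
    using that assms by (intro mpoly_var_closed list_update_plucker_index) (simp_all add: X_coords_def)
  then have "(\<Prod>j<d. mp_var (t[snd x j := (fst x, j)]) :: (_, 'a) mpoly)
      \<in> carrier (mpoly_ring (plucker_index (X_coords r d) k))"
    by (intro mpoly_prod_closed) simp
  then show "(if choice_monomial d (snd x) = m then \<Prod>j<d. mp_var (t[snd x j := (fst x, j)]) else 0 :: (_, 'a) mpoly)
      \<in> carrier (mpoly_ring (plucker_index (X_coords r d) k))"
    by simp
qed

section \<open>Points of the Fano scheme and their stability under torus degeneration\<close>

definition fano_points :: "nat \<Rightarrow> nat \<Rightarrow> nat \<Rightarrow> ((nat \<times> nat) list, 'a::comm_ring_1) mpoly set set" where
  "fano_points r d k = {P \<in> proj_points (plucker_index (X_coords r d) k).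
     plucker_ideal (X_coords r d) k \<subseteq> P \<and>
     (\<forall>t\<in>plucker_index (X_coords r d) k. \<forall>m. fano_coeff r d k t m \<in> P)}"

lemma fano_scheme_X_form:
  "fano_scheme (X_coords r d) (X_form r d) k =
    subtopology (zariski (plucker_index (X_coords r d) k)) (fano_points r d k)"
proof -
  have "fano_equations (X_coords r d) (X_form r d) k =
      {fano_coeff r d k t m | t m. t \<in> plucker_index (X_coords r d) k}"
    unfolding fano_equations_def lookup_pullback_X_form ..
  then show ?thesis
    unfolding fano_scheme_def
    by (intro arg_cong[where f = "subtopology _"]) (auto simp: proj_closed_def fano_points_def)
qed

lemma topspace_fano_scheme_X_form:
  "topspace (fano_scheme (X_coords r d) (X_form r d) k) = fano_points r d k"
  by (auto simp: fano_scheme_X_form topspace_zariski fano_points_def)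

lemma fano_pointsD:
  assumes "P \<in> fano_points r d k"
  shows "P \<in> proj_points (plucker_index (X_coords r d) k)"
    and "mpoly_prime (plucker_index (X_coords r d) k) P"
    and "p \<in> plucker_ideal (X_coords r d) k \<Longrightarrow> p \<in> P"
    and "t \<in> plucker_index (X_coords r d) k \<Longrightarrow> fano_coeff r d k t m \<in> P"
  using assms by (auto simp: fano_points_def intro: proj_pointD)

lemma fano_points_distinct:
  assumes "P \<in> fano_points r d k" "t \<in> plucker_index (X_coords r d) k" "mp_var t \<notin> P"
  shows "distinct t"
  using assms plucker_not_distinct fano_pointsD(3) by blast

text \<open>The torus preserves the hypersurface: the Pluecker ideal and the Fano coefficients are
  homogeneous for its weights, and homogeneous elements of \<open>P\<close> lie in the core.\<close>

lemma wcore_fano_points: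
  fixes P :: "((nat \<times> nat) list, 'a::comm_ring_1) mpoly set"
  assumes P: "P \<in> fano_points r d k" and w: "\<And>i. i < r \<Longrightarrow> (\<Sum>j<d. w (i, j)) = 0"
  shows "wcore (plucker_index (X_coords r d) k) (tuple_weight k w) P \<in> fano_points r d k"
proof -
  interpret mpoly_prime "plucker_index (X_coords r d) k" P
    using P by (rule fano_pointsD)
  show ?thesis
    unfolding fano_points_def
  proof (intro CollectI conjI ballI allI subsetI)
    fix p :: "((nat \<times> nat) list, 'a) mpoly"
    assume p: "p \<in> plucker_ideal (X_coords r d) k"
    have "wcomp (tuple_weight k w) n p \<in> P" for n
      using fano_pointsD(3)[OF P wcomp_plucker_ideal[OF p, of 0 w n]] by simp
    then show "p \<in> wcore (plucker_index (X_coords r d) k) (tuple_weight k w) P"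
      using p by (simp add: wcore_def plucker_ideal_def)
  next
    fix t m assume t: "t \<in> plucker_index (X_coords r d) k"
    then have "whomog (\<lambda>s. 0 + tuple_weight k w s)
        (int d * (0 + tuple_weight k w t) - wdeg (\<lambda>a. w (t ! a)) m)
        (fano_coeff r d k t m :: (_, 'a) mpoly)"
      by (intro whomog_fano_coeff w) (auto simp: plucker_index_def)
    then show "fano_coeff r d k t m \<in> wcore (plucker_index (X_coords r d) k) (tuple_weight k w) P"
      using whomog_mem_wcore[OF _ fano_pointsD(4)[OF P t]] by simp
  qed (rule wcore_proj_point[OF fano_pointsD(1)[OF P]])
qed

text \<open>The point of the Grassmannian given by a matrix \<open>M\<close> with entries in an integral domain to which
  the base ring maps by \<open>h\<close>.\<close>

definition matrix_point :: "'c set \<Rightarrow> nat \<Rightarrow> ('a \<Rightarrow> 'b::comm_ring_1) \<Rightarrow> (nat \<times> 'c \<Rightarrow> 'b) \<Rightarrow>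
    ('c list, 'a::comm_ring_1) mpoly set" where
  "matrix_point C k h M = wcore (plucker_index C k) (\<lambda>_. 1)
     {p \<in> carrier (mpoly_ring (plucker_index C k)). mp_subst h (minor k M) p = 0}"

text \<open>If a coordinate of each row vanishes on the plane, so does every product in the form. In
  the equations this shows as a factor that is a minor with a zero column.\<close>

lemma matrix_point_fano_points:
  fixes h :: "'a::comm_ring_1 \<Rightarrow> 'b::idom"
  assumes h: "comm_ring_hom h" and t: "t \<in> plucker_index (X_coords r d) k" "minor k M t \<noteq> 0"
    and M: "\<And>i. i < r \<Longrightarrow> \<exists>j<d. \<forall>a\<le>k. M (a, (i, j)) = 0"
  shows "matrix_point (X_coords r d) k h M \<in> fano_points r d k"
proof -
  let ?V = "plucker_index (X_coords r d) k"
  let ?f = "mp_subst h (minor k M)"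
  note hom = comm_ring_hom_mp_subst[OF h]
  interpret f: comm_ring_hom ?f by (rule hom)
  have plucker: "?f p = 0" if "p \<in> plucker_ideal (X_coords r d) k" for p
  proof -
    interpret M: comm_ring_hom "mp_subst h M" by (rule comm_ring_hom_mp_subst[OF h])
    have "mp_subst mp_const (generic_minor k) p = 0"
      using that by (simp add: plucker_ideal_def)
    then have "mp_subst h M (mp_subst mp_const (generic_minor k) p) = 0"
      by (simp only: M.hom_zero)
    then show ?thesis
      unfolding mp_subst_mp_subst[OF h] mp_subst_generic_minor[OF h] .
  qed
  have fano: "?f (fano_coeff r d k s m) = 0" if s: "s \<in> ?V" for s m
  proof -
    have "?f (\<Prod>j<d. mp_var (s[g j := (i, j)])) = 0"
      if i: "i < r" and g: "g \<in> {..<d} \<rightarrow>\<^sub>E {..k}" for i g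
    proof -
      obtain j where j: "j < d" "\<forall>a\<le>k. M (a, (i, j)) = 0" using M[OF i] by blast
      have "g j \<le> k" using g j(1) by auto
      then have "minor k M (s[g j := (i, j)]) = 0"
        using s j(2) by (intro minor_zero_column[of "g j"]) (auto simp: plucker_index_def)
      then have "\<exists>j\<in>{..<d}. ?f (mp_var (s[g j := (i, j)])) = 0"
        using j(1) h by (intro bexI[of _ j]) simp_all
      then show ?thesis
        unfolding f.hom_prod by (intro prod_zero) simp_all
    qed
    then have "?f (if choice_monomial d (snd x) = m then \<Prod>j<d. mp_var (s[snd x j := (fst x, j)]) else 0) = 0"
      if "x \<in> {..<r} \<times> ({..<d} \<rightarrow>\<^sub>E {..k})" for x
      using that by (simp add: mem_Times_iff)
    then show ?thesis
      unfolding fano_coeff_def f.hom_sum case_prod_beta by (intro sum.neutral ballI)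
  qed
  define K where "K = {p \<in> carrier (mpoly_ring ?V). ?f p = 0}"
  interpret mpoly_prime ?V K
    unfolding K_def by (rule mpoly_prime.intro) (rule kernel_primeideal[OF hom])
  show ?thesis
    unfolding matrix_point_def fano_points_def K_def[symmetric]
  proof (intro CollectI conjI ballI allI subsetI)
    have "?f (mp_var t) \<noteq> 0" using t(2) h by simp
    then have "\<not> mp_var ` ?V \<subseteq> K"
      using t(1) unfolding K_def by blast
    then show "wcore ?V (\<lambda>_. 1) K \<in> proj_points ?V"
      by (rule wcore_one_proj_point)
  next
    fix p :: "((nat \<times> nat) list, 'a) mpoly"
    assume p: "p \<in> plucker_ideal (X_coords r d) k"
    have closed: "q \<in> carrier (mpoly_ring ?V)" if "q \<in> plucker_ideal (X_coords r d) k"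
      for q :: "(_, 'a) mpoly"
      using that by (simp add: plucker_ideal_def)
    \<comment> \<open>With \<open>e = 1\<close> and no column weights this is the standard
      grading.\<close>
    have "wcomp (\<lambda>_. 1) n p \<in> plucker_ideal (X_coords r d) k" for n
      using wcomp_plucker_ideal[OF p, of 1 "\<lambda>_. 0" n] by (simp add: tuple_weight_def)
    then show "p \<in> wcore ?V (\<lambda>_. 1) K"
      using closed[OF p] closed plucker unfolding wcore_def K_def by blast
  next
    fix s m assume s: "s \<in> ?V"
    have "whomog (\<lambda>_. 1) (int d) (fano_coeff r d k s m :: (_, 'a) mpoly)"
      using whomog_fano_coeff[where r = r and d = d and w = "\<lambda>_. 0" and t = s and k = k and e = 1 and m = m] s
      by (simp add: tuple_weight_def plucker_index_def wdeg_def)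
    moreover have "fano_coeff r d k s m \<in> K"
      unfolding K_def using fano[OF s] fano_coeff_closed[OF s] by blast
    ultimately show "fano_coeff r d k s m \<in> wcore ?V (\<lambda>_. 1) K"
      by (rule whomog_mem_wcore)
  qed
qed

text \<open>Relations among the minors of \<open>M\<close> persist under the specialization
  \<open>f\<close>; so the point of \<open>M\<close> is a generization of that of
  \<open>M'\<close>.\<close>

lemma matrix_point_subset:
  assumes f: "comm_ring_hom f" "\<And>c. f (h c) = h' c" "\<And>a c. a \<le> k \<Longrightarrow> f (M (a, c)) = M' (a, c)"
  shows "matrix_point C k h M \<subseteq> matrix_point C k h' M'"
proof -
  interpret f: comm_ring_hom f by (rule f(1))
  have "f (minor k M t) = minor k M' t" for t
    unfolding hom_minor[OF f(1), of k M] unfolding minor_def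
    by (intro arg_cong[where f = det] eq_matI) (auto simp: f(3))
  then have "mp_subst h' (minor k M') p = f (mp_subst h (minor k M) p)" for p
    unfolding hom_mp_subst[OF f(1)] f(2) by simp
  then show ?thesis
    by (auto simp: matrix_point_def wcore_def)
qed

text \<open>Let \<open>(i', g)\<close> be a term with the same monomial and nonzero modulo
  \<open>P\<close>. Maximality gives \<open>w (i', j) <= w (t ! g j)\<close>, but both sides sum to
  zero over \<open>j\<close>. Hence equality holds, and injectivity of \<open>w\<close> identifies
  the term with the one that leaves \<open>t\<close> unchanged in every factor.\<close>

lemma fano_points_no_full_row:
  assumes P: "P \<in> fano_points r d k"
    and w0: "\<And>i. i < r \<Longrightarrow> (\<Sum>j<d. w (i, j)) = 0" and inj: "inj_on w (X_coords r d)"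
    and t: "t \<in> plucker_index (X_coords r d) k" "mp_var t \<notin> P"
    and max: "\<And>s. s \<in> plucker_index (X_coords r d) k \<Longrightarrow> mp_var s \<notin> P \<Longrightarrow>
      tuple_weight k w s \<le> tuple_weight k w t"
    and i: "i < r" and d: "0 < d"
  shows "\<exists>j<d. (i, j) \<notin> set t"
proof (rule ccontr)
  assume "\<not> ?thesis"
  then have full: "\<And>j. j < d \<Longrightarrow> (i, j) \<in> set t" by blast
  let ?V = "plucker_index (X_coords r d) k"
  interpret mpoly_prime ?V P using P by (rule fano_pointsD)
  have len: "length t = Suc k" and sub: "set t \<subseteq> X_coords r d"
    using t by (auto simp: plucker_index_def)
  have "\<forall>j\<in>{..<d}. \<exists>a. a \<le> k \<and> t ! a = (i, j)"
    using full len by (metis in_set_conv_nth less_Suc_eq_le lessThan_iff)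
  then obtain idx where idx: "\<And>j. j < d \<Longrightarrow> idx j \<le> k \<and> t ! idx j = (i, j)"
    by (metis lessThan_iff)
  define g0 where "g0 = restrict idx {..<d}"
  have g0: "g0 \<in> {..<d} \<rightarrow>\<^sub>E {..k}" "\<And>j. j < d \<Longrightarrow> g0 j = idx j"
    using idx by (auto simp: g0_def)
  let ?m = "choice_monomial d g0"
  let ?T = "\<lambda>(i, g). if choice_monomial d g = ?m
    then \<Prod>j<d. mp_var (t[g j := (i, j)]) else 0 :: ((nat \<times> nat) list, 'a) mpoly"
  have closed: "mp_var (t[a := (i', j)]) \<in> carrier (mpoly_ring ?V)" if "i' < r" "j < d" for a i' j
    using that t by (intro mpoly_var_closed list_update_plucker_index) (auto simp: X_coords_def)
  have other: "?T y \<in> P" if y: "y \<in> {..<r} \<times> ({..<d} \<rightarrow>\<^sub>E {..k})" "y \<noteq> (i, g0)" for y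
  proof (rule ccontr)
    assume notP: "?T y \<notin> P"
    obtain i' g where y_eq: "y = (i', g)" by force
    have i': "i' < r" and g: "g \<in> {..<d} \<rightarrow>\<^sub>E {..k}" using y y_eq by auto
    have gk: "g j \<le> k" if "j < d" for j using g that by auto
    have m: "choice_monomial d g = ?m" using notP by (auto simp: y_eq split: if_splits)
    have "mp_var (t[g j := (i', j)]) \<notin> P" if "j < d" for j
      using notP that closed[OF i'] prod_mem[of "{..<d}" j "\<lambda>j. mp_var (t[g j := (i', j)])"]
      by (auto simp: y_eq split: if_splits)
    then have "tuple_weight k w (t[g j := (i', j)]) \<le> tuple_weight k w t" if "j < d" for j
      using that t i' by (intro max list_update_plucker_index) (auto simp: X_coords_def)
    then have le: "w (i', j) \<le> w (t ! g j)" if "j < d" for j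
      using that gk[OF that] by (fastforce simp: tuple_weight_update[OF len])
    have "(\<Sum>j<d. w (t ! g j)) = (\<Sum>j<d. w (t ! g0 j))"
      using m wdeg_choice_monomial[of "\<lambda>a. w (t ! a)"] by metis
    also have "\<dots> = (\<Sum>j<d. w (i, j))"
      by (intro sum.cong refl) (use g0 idx in auto)
    finally have sum_eq: "(\<Sum>j<d. w (i', j)) = (\<Sum>j<d. w (t ! g j))"
      using w0 i i' by simp
    have "w (i', j) = w (t ! g j)" if "j < d" for j
      using sum_mono_inv[OF sum_eq, of j] le that by auto
    moreover have "t ! g j \<in> X_coords r d" "(i', j) \<in> X_coords r d" if "j < d" for j
      using gk[OF that] sub len i' that nth_mem[of "g j" t] by (auto simp: X_coords_def)
    ultimately have tg: "t ! g j = (i', j)" if "j < d" for j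
      using that inj_onD[OF inj] by metis
    \<comment> \<open>Equal monomials use the same positions of \<open>t\<close>, so the entry
      \<open>(i', j)\<close> found there is also some \<open>(i, j')\<close>.\<close>
    have img: "g ` {..<d} = g0 ` {..<d}" using m by (rule choice_monomial_eq_image)
    have gj: "i' = i \<and> g j = g0 j" if "j < d" for j
    proof -
      have "g j \<in> g0 ` {..<d}" using img that by (metis imageI lessThan_iff)
      then obtain j' where j': "j' < d" "g j = g0 j'" by (metis imageE lessThan_iff)
      then have "(i', j) = (i, j')" using tg[OF that] idx[of j'] g0(2)[of j'] by metis
      then show ?thesis using j' by simp
    qed
    have "g = g0"
    proof (rule PiE_ext[OF g g0(1)])
      show "g j = g0 j" if "j \<in> {..<d}" for j using gj[of j] that by simp
    qed
    moreover have "i' = i" using gj[OF d] by simp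
    ultimately show False using y(2) y_eq by simp
  qed
  have "(\<Sum>y\<in>{..<r} \<times> ({..<d} \<rightarrow>\<^sub>E {..k}). ?T y) \<in> P"
    using fano_pointsD(4)[OF P t(1), of ?m] by (simp add: fano_coeff_def)
  then have "?T (i, g0) \<in> P"
    by (subst (asm) sum_mem_iff[of _ "(i, g0)"]) (use i g0 other in \<open>auto simp: finite_PiE\<close>)
  moreover have "?T (i, g0) = mp_var t ^ d"
  proof -
    have "t[g0 j := (i, j)] = t" if "j < d" for j
      using idx[OF that] g0(2)[OF that] by (metis list_update_id)
    then have "(\<Prod>j<d. mp_var (t[g0 j := (i, j)]) :: (_, 'a) mpoly) = (\<Prod>j<d. mp_var t)"
      by (intro prod.cong) auto
    then show ?thesis by simp
  qed
  ultimately have "mp_var t ^ d \<in> P" by simp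
  then show False using power_mem t by auto
qed

section \<open>Coordinate planes\<close>

text \<open>The coordinate subspace spanned by the basis vectors in \<open>S\<close> is contained in the hypersurface iff
  \<open>S\<close> is row-proper.\<close>

definition row_proper :: "nat \<Rightarrow> nat \<Rightarrow> (nat \<times> nat) set \<Rightarrow> bool" where
  "row_proper r d S \<longleftrightarrow> S \<subseteq> X_coords r d \<and> (\<forall>i<r. \<exists>j<d. (i, j) \<notin> S)"

definition coord_point :: "nat \<Rightarrow> nat \<Rightarrow> nat \<Rightarrow> (nat \<times> nat) list \<Rightarrow>
    ((nat \<times> nat) list, 'a::comm_ring_1) mpoly set" where
  "coord_point r d k t = matrix_point (X_coords r d) k (\<lambda>x. x) (coord_mat t)"

lemma coord_point_fano_points:
  assumes t: "t \<in> plucker_index (X_coords r d) k" "distinct t" "row_proper r d (set t)"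
  shows "(coord_point r d k t :: ((nat \<times> nat) list, 'a::idom) mpoly set) \<in> fano_points r d k"
  unfolding coord_point_def
proof (rule matrix_point_fano_points[OF comm_ring_hom_id t(1)])
  have len: "length t = Suc k" using t(1) by (simp add: plucker_index_def)
  show "minor k (coord_mat t) t \<noteq> (0 :: 'a)"
    by (simp add: minor_coord_mat_self[OF t(2) len])
  fix i assume "i < r"
  then obtain j where j: "j < d" "(i, j) \<notin> set t" using t(3) by (auto simp: row_proper_def)
  then have "t ! a \<noteq> (i, j)" if "a \<le> k" for a
    using that len by (metis le_imp_less_Suc nth_mem)
  then show "\<exists>j<d. \<forall>a\<le>k. coord_mat t (a, (i, j)) = (0 :: 'a)"
    using j(1) by (intro exI[of _ j]) (simp add: coord_mat_def)
qed

lemma mp_var_mem_coord_point: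
  assumes "s \<in> plucker_index (X_coords r d) k"
  shows "mp_var s \<in> (coord_point r d k t :: ((nat \<times> nat) list, 'a::comm_ring_1) mpoly set) \<longleftrightarrow>
    minor k (coord_mat t) s = (0 :: 'a)"
proof -
  have w: "wcomp (\<lambda>_. 1) n (mp_var s :: ((nat \<times> nat) list, 'a) mpoly) = (if n = 1 then mp_var s else 0)" for n
    by (rule wcomp_whomog[OF whomog_var])
  have z: "mp_subst (\<lambda>x. x) (minor k (coord_mat t)) 0 = (0 :: 'a)"
    by (simp add: mp_subst_def)
  show ?thesis
    using assms unfolding coord_point_def matrix_point_def wcore_def
    by (auto simp: w z comm_ring_hom_id)
qed

text \<open>\<open>R\<close> is the generic point of the pencil in which the basis vector of
  \<open>t ! a\<close> moves to that of \<open>c\<close>. Its planes lie in the coordinate subspace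
  of \<open>insert c (set t)\<close>, hence in the hypersurface.\<close>

lemma line_of_planes:
  assumes t: "t \<in> plucker_index (X_coords r d) k" "distinct t" and a: "a \<le> k"
    and c: "row_proper r d (insert c (set t))"
  obtains R where "R \<in> fano_points r d k"
    and "R \<subseteq> (coord_point r d k t :: ((nat \<times> nat) list, 'a::idom) mpoly set)"
    and "R \<subseteq> coord_point r d k (t[a := c])"
proof -
  have len: "length t = Suc k" using t(1) by (simp add: plucker_index_def)
  define h :: "'a \<Rightarrow> 'a poly poly" where "h = (\<lambda>x. [:[:x:]:])"
  \<comment> \<open>Row \<open>a\<close> is \<open>u\<close> times the basis vector of
    \<open>t ! a\<close> plus \<open>v\<close> times that of \<open>c\<close>, with \<open>u\<close>
    the inner and \<open>v\<close> the outer polynomial variable. Evaluation at (1, 0) and (0, 1)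
    gives the ends of the pencil.\<close>
  define M :: "nat \<times> (nat \<times> nat) \<Rightarrow> 'a poly poly" where
    "M = (\<lambda>(b, x). if b = a then [:[:0, 1:]:] * coord_mat t (b, x) + [:0, 1:] * coord_mat (t[a := c]) (b, x)
      else coord_mat t (b, x))"
  define ev :: "'a \<Rightarrow> 'a \<Rightarrow> 'a poly poly \<Rightarrow> 'a" where "ev u v = (\<lambda>p. poly (poly p [:v:]) u)" for u v
  have h: "comm_ring_hom h"
    unfolding h_def by (rule comm_ring_homI) (auto simp: one_pCons)
  have ev: "comm_ring_hom (ev u v)" for u v
    unfolding ev_def by (rule comm_ring_homI) auto
  have ev_h: "ev u v (h x) = x" for u v x
    by (simp add: ev_def h_def)
  have ev10: "ev 1 0 (M (b, x)) = coord_mat t (b, x)" for b x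
    by (simp add: ev_def M_def coord_mat_def)
  have ev01: "ev 0 1 (M (b, x)) = coord_mat (t[a := c]) (b, x)" if "b \<le> k" for b x
    using len a that by (simp add: ev_def M_def coord_mat_def nth_list_update)
  show thesis
  proof (rule that[of "matrix_point (X_coords r d) k h M"])
    show "matrix_point (X_coords r d) k h M \<in> fano_points r d k"
    proof (rule matrix_point_fano_points[OF h t(1)])
      have "ev 1 0 (minor k M t) = minor k (\<lambda>x. ev 1 0 (M x)) t"
        by (rule hom_minor[OF ev])
      also have "(\<lambda>x. ev 1 0 (M x)) = coord_mat t"
        using ev10 by auto
      also have "minor k (coord_mat t) t = (1 :: 'a)"
        by (rule minor_coord_mat_self[OF t(2) len])
      finally show "minor k M t \<noteq> 0" by (auto simp: ev_def)
    next
      fix i assume "i < r"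
      then obtain j where "j < d" "(i, j) \<notin> insert c (set t)"
        using c by (auto simp: row_proper_def)
      moreover from this have "t ! b \<noteq> (i, j)" if "b \<le> k" for b
        using that len by (metis insertCI le_imp_less_Suc nth_mem)
      ultimately show "\<exists>j<d. \<forall>b\<le>k. M (b, (i, j)) = 0"
        using len a by (intro exI[of _ j]) (auto simp: M_def coord_mat_def)
    qed
    show "matrix_point (X_coords r d) k h M \<subseteq> coord_point r d k t"
      unfolding coord_point_def by (rule matrix_point_subset[OF ev[of 1 0]]) (simp_all add: ev_h ev10)
    show "matrix_point (X_coords r d) k h M \<subseteq> coord_point r d k (t[a := c])"
      unfolding coord_point_def by (rule matrix_point_subset[OF ev[of 0 1]]) (simp_all add: ev_h ev01)
  qed
qed

section \<open>Degeneration to coordinate planes\<close>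

lemma mon_eval_mult: "mon_eval (\<lambda>v. f v * g v) m = mon_eval f m * mon_eval g m"
  by (simp add: mon_eval_def power_mult_distrib prod.distrib)

lemma mon_eval_const: "mon_eval (\<lambda>_. x) m = x ^ mon_deg m"
  by (simp add: mon_eval_def mon_deg_def power_sum)

lemma int_mon_deg: "int (mon_deg m) = wdeg (\<lambda>_. 1) m"
  by (simp add: mon_deg_def wdeg_def)

lemma mon_eval_mp_const: "mon_eval (\<lambda>v. mp_const (f v)) m = mp_const (mon_eval f m)"
proof -
  interpret comm_ring_hom mp_const by (rule comm_ring_hom_mp_const)
  show ?thesis by (simp add: mon_eval_def hom_prod hom_power)
qed

lemma mon_eval_mp_var:
  "mon_eval mp_var m = (Poly_Mapping.single m 1 :: ('v, 'a::comm_ring_1) mpoly)"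
proof -
  have "mp_var v ^ e = (Poly_Mapping.single (Poly_Mapping.single v e) 1 :: ('v, 'a) mpoly)" for v e
    by (induction e) (simp_all add: mp_var_def mult_single flip: single_add)
  then show ?thesis
    by (simp add: mon_eval_def prod_single poly_mapping_sum_single)
qed

lemma mp_subst_mp_const_mp_var: "mp_subst mp_const mp_var p = p"
  by (simp add: mp_subst_superset[OF comm_ring_hom_mp_const _ subset_refl] mon_eval_mp_var
      mp_const_def mult_single poly_mapping_sum_single)

context mpoly_prime
begin

lemma cong_mult:
  assumes "x - y \<in> P" "x' - y' \<in> P" "x \<in> carrier (mpoly_ring V)" "y' \<in> carrier (mpoly_ring V)"
  shows "x * x' - y * y' \<in> P"
proof -
  have "x * x' - y * y' = x * (x' - y') + (x - y) * y'" by (simp add: algebra_simps)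
  then show ?thesis
    using add_mem[OF mult_mem_left[OF assms(2,3)] mult_mem_right[OF assms(1,4)]] by simp
qed

lemma cong_power:
  assumes "x - y \<in> P" "x \<in> carrier (mpoly_ring V)" "y \<in> carrier (mpoly_ring V)"
  shows "x ^ e - y ^ e \<in> P"
proof (induction e)
  case (Suc e)
  then show ?case
    using cong_mult[OF assms(1) Suc.IH assms(2) mpoly_power_closed[OF assms(3)]] by simp
qed simp

lemma cong_mon_eval:
  assumes "\<And>v. v \<in> Poly_Mapping.keys m \<Longrightarrow> f v - g v \<in> P"
    and "\<And>v. v \<in> Poly_Mapping.keys m \<Longrightarrow> f v \<in> carrier (mpoly_ring V)"
    and "\<And>v. v \<in> Poly_Mapping.keys m \<Longrightarrow> g v \<in> carrier (mpoly_ring V)"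
  shows "mon_eval f m - mon_eval g m \<in> P"
proof -
  have "(\<Prod>v\<in>A. f v ^ Poly_Mapping.lookup m v) - (\<Prod>v\<in>A. g v ^ Poly_Mapping.lookup m v) \<in> P"
    if "A \<subseteq> Poly_Mapping.keys m" for A
    using finite_subset[OF that finite_keys] that
  proof (induction A rule: finite_induct)
    case (insert v A)
    then have v: "v \<in> Poly_Mapping.keys m" and A: "A \<subseteq> Poly_Mapping.keys m" by auto
    have "(\<Prod>v\<in>A. g v ^ Poly_Mapping.lookup m v) \<in> carrier (mpoly_ring V)"
      using A assms(3) by (intro mpoly_prod_closed mpoly_power_closed) blast
    then show ?case
      unfolding prod.insert[OF insert.hyps(1,2)]
      using insert.IH[OF A] assms v by (intro cong_mult cong_power mpoly_power_closed) auto
  qed simp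
  then show ?thesis unfolding mon_eval_def by blast
qed

lemma mon_eval_mem:
  assumes "v \<in> Poly_Mapping.keys m" "f v \<in> P"
    and "\<And>v. v \<in> Poly_Mapping.keys m \<Longrightarrow> f v \<in> carrier (mpoly_ring V)"
  shows "mon_eval f m \<in> P"
proof -
  obtain e where "Poly_Mapping.lookup m v = Suc e"
    using assms(1) by (metis in_keys_iff not0_implies_Suc)
  then have "f v ^ Poly_Mapping.lookup m v \<in> P"
    using mult_mem_right[OF assms(2) mpoly_power_closed[OF assms(3)[OF assms(1)]]] by simp
  then show ?thesis
    unfolding mon_eval_def using assms
    by (intro prod_mem[of _ v] mpoly_power_closed) auto
qed

end

lemma finite_X_coords: "finite (X_coords r d)"
  by (simp add: X_coords_def)

lemma finite_plucker_index: "finite C \<Longrightarrow> finite (plucker_index C k)"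
  unfolding plucker_index_def using finite_lists_length_eq[of C "Suc k"]
  by (simp add: conj_commute)

text \<open>The coordinate plane of \<open>t\<close> is the limit of \<open>P\<close> under the one-parameter subgroup with weights \<open>w\<close>;
  the orbit closure has the generic point \<open>R\<close>.\<close>

lemma degeneration:
  fixes P :: "((nat \<times> nat) list, 'a::field) mpoly set"
  assumes P: "P \<in> fano_points r d k" and d: "2 \<le> d"
    and w0: "\<And>i. i < r \<Longrightarrow> (\<Sum>j<d. w (i, j)) = 0"
    and inj: "inj_on (sum w) {S. row_proper r d S}"
    and t: "t \<in> plucker_index (X_coords r d) k" "mp_var t \<notin> P"
    and max: "\<And>s. s \<in> plucker_index (X_coords r d) k \<Longrightarrow> mp_var s \<notin> P \<Longrightarrow>
      tuple_weight k w s \<le> tuple_weight k w t"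
  obtains R where "R \<in> fano_points r d k" "R \<subseteq> P" "R \<subseteq> coord_point r d k t"
    and "row_proper r d (set t)" "distinct t"
proof -
  let ?V = "plucker_index (X_coords r d) k"
  let ?W = "tuple_weight k w t"
  interpret mpoly_prime ?V P using P by (rule fano_pointsD)
  \<comment> \<open>Singletons are row-proper once rows have two entries, so the weights also
    separate single coordinates.\<close>
  have injw: "inj_on w (X_coords r d)"
  proof (rule inj_onI)
    fix c c' assume c: "c \<in> X_coords r d" "c' \<in> X_coords r d" "w c = w c'"
    have proper: "row_proper r d {x}" if "x \<in> X_coords r d" for x
    proof -
      have "\<exists>j<d. (i, j) \<noteq> x" for i
        using d by (cases "x = (i, 0)") (auto intro: exI[of _ 1] exI[of _ 0])
      then show ?thesis using that by (simp add: row_proper_def)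
    qed
    show "c = c'"
      using inj_onD[OF inj, of "{c}" "{c'}"] c proper[of c] proper[of c'] by simp
  qed
  have proper: "row_proper r d (set s)" and dist: "distinct s"
    if s: "s \<in> ?V" "mp_var s \<notin> P" "tuple_weight k w s = ?W" for s
  proof -
    have "\<exists>j<d. (i, j) \<notin> set s" if "i < r" for i
      by (rule fano_points_no_full_row[OF P w0 injw s(1,2) _ that]) (use s(3) max d in auto)
    then show "row_proper r d (set s)"
      using s(1) by (simp add: row_proper_def plucker_index_def)
    show "distinct s" by (rule fano_points_distinct[OF P s(1,2)])
  qed
  note tp = proper[OF t refl] and td = dist[OF t refl]
  have len: "length s = Suc k" if "s \<in> ?V" for s using that by (simp add: plucker_index_def)
  let ?E = "minor k (coord_mat t) :: (nat \<times> nat) list \<Rightarrow> 'a"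
  \<comment> \<open>Only rearrangements of \<open>t\<close> have a nonzero minor on the coordinate
    plane of \<open>t\<close>.\<close>
  have E_weight: "tuple_weight k w s = ?W" if s: "s \<in> ?V" and E: "?E s \<noteq> 0" for s
  proof -
    have "set s \<subseteq> set t" using minor_coord_mat_eq_0[OF len[OF s] len[OF t(1)]] E by blast
    moreover have ds: "distinct s" using minor_not_distinct[OF _ len[OF s]] E by blast
    ultimately have "set s = set t"
      by (intro card_subset_eq) (simp_all add: distinct_card td len[OF s] len[OF t(1)])
    then show ?thesis
      by (simp add: tuple_weight_distinct[OF len[OF s] ds] tuple_weight_distinct[OF len[OF t(1)] td])
  qed
  \<comment> \<open>In weights not below that of \<open>t\<close>, the coordinates of
    \<open>P\<close> are those of the coordinate plane times \<open>p_t\<close>: by maximality and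
    separation, a coordinate not supported on \<open>set t\<close> vanishes at
    \<open>P\<close>.\<close>
  have var_cong: "mp_var s - mp_const (?E s) * mp_var t \<in> P"
    if s: "s \<in> ?V" and le: "?W \<le> tuple_weight k w s" for s
  proof (cases "set s \<subseteq> set t")
    case True
    show ?thesis by (rule fano_pointsD(3)[OF P plucker_subset[OF t(1) td s True]])
  next
    case False
    have "mp_var s \<in> P"
    proof (rule ccontr)
      assume sP: "mp_var s \<notin> P"
      have eq: "tuple_weight k w s = ?W" using max[OF s sP] le by simp
      have "sum w (set s) = sum w (set t)"
        using eq by (simp add: tuple_weight_distinct[OF len[OF s] dist[OF s sP eq]]
          tuple_weight_distinct[OF len[OF t(1)] td])
      then have "set s = set t"
        using inj_onD[OF inj] proper[OF s sP eq] tp by blast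
      then show False using False by simp
    qed
    then show ?thesis
      using minor_coord_mat_eq_0[OF len[OF s] len[OF t(1)] False, where 'b = 'a] by simp
  qed
  define R where "R = wcore ?V (tuple_weight k w) P"
  have "f \<in> coord_point r d k t" if f: "f \<in> R" for f
  proof -
    have fc: "f \<in> carrier (mpoly_ring ?V)" using f by (simp add: R_def wcore_def)
    have "mp_subst (\<lambda>x. x) ?E (wcomp (\<lambda>_. 1) n f) = 0" for n
    proof (cases "n < 0")
      case True
      have "wcomp (\<lambda>_. 1) n f = 0"
      proof (rule poly_mapping_eqI)
        fix m show "Poly_Mapping.lookup (wcomp (\<lambda>_. 1) n f) m = Poly_Mapping.lookup 0 m"
          using True int_mon_deg[of m] by (auto simp: lookup_wcomp)
      qed
      then show ?thesis by (simp add: mp_subst_def)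
    next
      case False
      then obtain e where e: "n = int e" by (metis nonneg_int_cases not_less)
      define q where "q = wcomp (\<lambda>_. 1) n f"
      \<comment> \<open>Monomials of degree \<open>e\<close> in rearrangements of \<open>t\<close>
        have weight \<open>e * ?W\<close>, so this is the only component of \<open>q\<close> that
        the coordinate plane sees.\<close>
      define q' where "q' = wcomp (tuple_weight k w) (n * ?W) q"
      have qc: "q \<in> carrier (mpoly_ring ?V)" using fc by (simp add: q_def)
      have "q' = hom_part e (wcomp (tuple_weight k w) (n * ?W) f)"
        unfolding q'_def q_def e hom_part_eq_wcomp by (rule wcomp_commute)
      moreover have "wcomp (tuple_weight k w) (n * ?W) f \<in> P"
        using f by (simp add: R_def wcore_def)
      ultimately have q'P: "q' \<in> P"
        using proj_pointD(2)[OF fano_pointsD(1)[OF P]] by simp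
      have keys: "Poly_Mapping.keys m \<subseteq> ?V" if "m \<in> Poly_Mapping.keys q" for m
        using that qc by (simp add: mpoly_ring_mem)
      have deg: "mon_deg m = e" if "m \<in> Poly_Mapping.keys q" for m
        using that int_mon_deg[of m] by (simp add: q_def keys_wcomp e)
      have keys': "Poly_Mapping.keys q' \<subseteq> Poly_Mapping.keys q"
        by (auto simp: q'_def keys_wcomp)
      have mon_cong: "mon_eval mp_var m - mp_const (mon_eval ?E m) * mp_var t ^ e \<in> P"
        if m: "m \<in> Poly_Mapping.keys q'" for m
      proof (cases "\<forall>s\<in>Poly_Mapping.keys m. ?W \<le> tuple_weight k w s")
        case True
        have mV: "Poly_Mapping.keys m \<subseteq> ?V" using keys keys' m by blast
        have "mon_eval mp_var m - mon_eval (\<lambda>s. mp_const (?E s) * mp_var t) m \<in> P"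
        proof (rule cong_mon_eval)
          fix s assume s: "s \<in> Poly_Mapping.keys m"
          then show "mp_var s - mp_const (?E s) * mp_var t \<in> P"
            using True mV by (intro var_cong) blast+
          show "mp_var s \<in> carrier (mpoly_ring ?V)"
            using s mV by (intro mpoly_var_closed) blast
          show "mp_const (?E s) * mp_var t \<in> carrier (mpoly_ring ?V)"
            by (intro mpoly_mult_closed mpoly_const_closed mpoly_var_closed t)
        qed
        then show ?thesis
          using deg[of m] keys' m by (simp add: mon_eval_mult mon_eval_mp_const mon_eval_const subset_iff)
      next
        case False
        have mV: "Poly_Mapping.keys m \<subseteq> ?V" using keys keys' m by blast
        from False obtain s where s: "s \<in> Poly_Mapping.keys m" "tuple_weight k w s < ?W"
          by (auto simp: not_le)
        have "?E s = 0" using E_weight[of s] s mV by fastforce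
        then have Em: "mon_eval ?E m = 0"
          unfolding mon_eval_def using s(1) by (intro prod_zero bexI[of _ s]) (auto simp: in_keys_iff)
        \<comment> \<open>The weights of the factors average to \<open>?W\<close>; a factor below
          the average forces one above it, which vanishes at \<open>P\<close>.\<close>
        have "\<exists>s'\<in>Poly_Mapping.keys m. ?W < tuple_weight k w s'"
        proof (rule ccontr)
          assume "\<not> ?thesis"
          then have le: "tuple_weight k w s' \<le> ?W" if "s' \<in> Poly_Mapping.keys m" for s'
            using that by (auto simp: not_less)
          have "wdeg (tuple_weight k w) m < (\<Sum>s\<in>Poly_Mapping.keys m. int (Poly_Mapping.lookup m s) * ?W)"
            unfolding wdeg_def
          proof (rule sum_strict_mono_ex1)
            show "\<forall>s\<in>Poly_Mapping.keys m. int (Poly_Mapping.lookup m s) * tuple_weight k w s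
                \<le> int (Poly_Mapping.lookup m s) * ?W"
              using le by (simp add: mult_left_mono)
            show "\<exists>s\<in>Poly_Mapping.keys m. int (Poly_Mapping.lookup m s) * tuple_weight k w s
                < int (Poly_Mapping.lookup m s) * ?W"
              using s by (intro bexI[of _ s]) (auto simp: in_keys_iff)
          qed simp
          also have "\<dots> = int (mon_deg m) * ?W"
            by (simp add: mon_deg_def sum_distrib_right)
          finally show False
            using m deg[of m] keys' by (auto simp: q'_def keys_wcomp e)
        qed
        then obtain s' where s': "s' \<in> Poly_Mapping.keys m" "?W < tuple_weight k w s'" by blast
        then have "mp_var s' \<in> P" using max[of s'] mV by fastforce
        then have "mon_eval mp_var m \<in> P"
          using s'(1) mV by (intro mon_eval_mem[of s']) (auto intro!: mpoly_var_closed)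
        then show ?thesis using Em by simp
      qed
      \<comment> \<open>Modulo \<open>P\<close>, \<open>q'\<close> is its value on the coordinate
        plane times \<open>p_t ^ e\<close>. Since \<open>q'\<close> is in \<open>P\<close> and
        \<open>p_t\<close> is not, this value, a scalar of the field, is zero.\<close>
      have "q' - mp_const (mp_subst (\<lambda>x. x) ?E q') * mp_var t ^ e =
        (\<Sum>m\<in>Poly_Mapping.keys q'. mp_const (Poly_Mapping.lookup q' m) *
          (mon_eval mp_var m - mp_const (mon_eval ?E m) * mp_var t ^ e))"
      proof -
        interpret c: comm_ring_hom "mp_const :: 'a \<Rightarrow> ((nat \<times> nat) list, 'a) mpoly"
          by (rule comm_ring_hom_mp_const)
        have "q' = (\<Sum>m\<in>Poly_Mapping.keys q'. mp_const (Poly_Mapping.lookup q' m) * mon_eval mp_var m)"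
          using mp_subst_superset[OF comm_ring_hom_mp_const _ subset_refl, of q' mp_var]
          by (simp add: mp_subst_mp_const_mp_var)
        moreover have "mp_const (mp_subst (\<lambda>x. x) ?E q') = (\<Sum>m\<in>Poly_Mapping.keys q'.
            mp_const (Poly_Mapping.lookup q' m) * mp_const (mon_eval ?E m) :: ((nat \<times> nat) list, 'a) mpoly)"
          by (simp add: mp_subst_superset[OF comm_ring_hom_id _ subset_refl] c.hom_sum c.hom_mult)
        ultimately show ?thesis
          by (simp add: right_diff_distrib sum_subtractf sum_distrib_right mult.assoc)
      qed
      also have "\<dots> \<in> P"
        using mon_cong by (intro sum_mem mult_mem_left mpoly_const_closed)
      finally have "mp_const (mp_subst (\<lambda>x. x) ?E q') * mp_var t ^ e \<in> P"
        using diff_mem[OF q'P] by fastforce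
      then have "mp_const (mp_subst (\<lambda>x. x) ?E q') \<in> P \<or> mp_var t ^ e \<in> P"
        using t(1) by (intro prime_mem mpoly_const_closed mpoly_power_closed mpoly_var_closed)
      then have "mp_const (mp_subst (\<lambda>x. x) ?E q') \<in> P"
        using power_mem t by blast
      then have "mp_subst (\<lambda>x. x) ?E q' = 0"
        using mp_const_notin[OF right_inverse] by blast
      moreover have "mp_subst (\<lambda>x. x) ?E q = mp_subst (\<lambda>x. x) ?E q'"
      proof -
        have "Poly_Mapping.lookup q m * mon_eval ?E m = Poly_Mapping.lookup q' m * mon_eval ?E m"
          if m: "m \<in> Poly_Mapping.keys q" for m
        proof (cases "mon_eval ?E m = 0")
          case False
          have "?E s \<noteq> 0" if "s \<in> Poly_Mapping.keys m" for s
            using False that unfolding mon_eval_def by (auto simp: in_keys_iff)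
          then have "tuple_weight k w s = ?W" if "s \<in> Poly_Mapping.keys m" for s
            using that keys[OF m] by (intro E_weight) blast+
          then have "wdeg (tuple_weight k w) m = int (mon_deg m) * ?W"
            by (simp add: wdeg_def mon_deg_def sum_distrib_right)
          then show ?thesis
            by (simp add: q'_def lookup_wcomp deg[OF m] e)
        qed simp
        then show ?thesis
          unfolding mp_subst_superset[OF comm_ring_hom_id finite_keys subset_refl, of ?E q]
            mp_subst_superset[OF comm_ring_hom_id finite_keys keys']
          by (rule sum.cong[OF refl])
      qed
      ultimately show ?thesis by (simp add: q_def)
    qed
    then show ?thesis
      unfolding coord_point_def matrix_point_def using fc by (simp add: wcore_def)
  qed
  then have "R \<subseteq> coord_point r d k t" by blast
  moreover have "R \<in> fano_points r d k" unfolding R_def by (rule wcore_fano_points[OF P w0])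
  moreover have "R \<subseteq> P" unfolding R_def by (rule wcore_subset)
  ultimately show thesis using tp td by (intro that)
qed


section \<open>Planes of maximal dimension\<close>

text \<open>One missing entry \<open>(i, m i)\<close> is chosen per row. The complements of such
  transversals are the maximal row-proper sets, whence the number
  \<open>r * (d - 1)\<close>.\<close>

lemma row_proper_transversal:
  assumes "row_proper r d S"
  obtains m where "\<And>i. i < r \<Longrightarrow> m i < d" "S \<subseteq> (SIGMA i:{..<r}. {..<d} - {m i})"
    and "card (SIGMA i:{..<r}. {..<d} - {m i}) = r * (d - 1)"
proof -
  obtain m where m: "\<And>i. i < r \<Longrightarrow> m i < d \<and> (i, m i) \<notin> S"
    using assms unfolding row_proper_def by metis
  have "S \<subseteq> (SIGMA i:{..<r}. {..<d} - {m i})"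
    using m assms by (fastforce simp: row_proper_def X_coords_def)
  moreover have "card (SIGMA i:{..<r}. {..<d} - {m i}) = (\<Sum>i<r. d - 1)"
    using m by (simp add: card_SigmaI)
  ultimately show thesis using that[of m] m by simp
qed

lemma row_proper_card:
  assumes "row_proper r d S"
  shows "finite S" "card S \<le> r * (d - 1)"
proof -
  obtain m where m: "S \<subseteq> (SIGMA i:{..<r}. {..<d} - {m i})"
    "card (SIGMA i:{..<r}. {..<d} - {m i}) = r * (d - 1)"
    using row_proper_transversal[OF assms] by metis
  have fin: "finite (SIGMA i:{..<r}. {..<d} - {m i})" by simp
  show "finite S" "card S \<le> r * (d - 1)"
    using finite_subset[OF m(1) fin] card_mono[OF fin m(1)] m(2) by simp_all
qed

lemma row_proper_extend:
  assumes "row_proper r d S" "card S < r * (d - 1)"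
  obtains c where "c \<in> X_coords r d" "c \<notin> S" "row_proper r d (insert c S)"
proof -
  obtain m where m: "\<And>i. i < r \<Longrightarrow> m i < d" "S \<subseteq> (SIGMA i:{..<r}. {..<d} - {m i})"
    "card (SIGMA i:{..<r}. {..<d} - {m i}) = r * (d - 1)"
    using row_proper_transversal[OF assms(1)] by metis
  then obtain c where c: "c \<in> (SIGMA i:{..<r}. {..<d} - {m i})" "c \<notin> S"
    using assms(2) by (metis less_irrefl subsetI subset_antisym)
  have "(i, m i) \<notin> insert c S" for i using c(1) m(2) by auto
  then have "row_proper r d (insert c S)"
    using c(1) m(1) assms(1) by (auto simp: row_proper_def X_coords_def)
  moreover have "c \<in> X_coords r d" using c(1) by (auto simp: X_coords_def)
  ultimately show thesis using that c(2) by blast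
qed

text \<open>By its size, \<open>t\<close> fills the complement of a transversal, and
  \<open>c\<close> is the missing entry of its row. Take the monomial formed by \<open>a\<close> and
  the positions of the other entries of this row. Its term is the coordinate of
  \<open>t[a := c]\<close> times \<open>p_t ^ (d - 1)\<close>, and all other terms of the
  coefficient vanish modulo \<open>P\<close>.\<close>

lemma fano_points_max_update:
  assumes P: "P \<in> fano_points r d k" and k: "Suc k = r * (d - 1)" and d: "3 \<le> d"
    and t: "t \<in> plucker_index (X_coords r d) k" "mp_var t \<notin> P" "row_proper r d (set t)"
    and c: "c \<in> X_coords r d" "c \<notin> set t" and a: "a \<le> k"
  shows "mp_var (t[a := c]) \<in> (P :: ((nat \<times> nat) list, 'a::comm_ring_1) mpoly set)"
proof -
  let ?V = "plucker_index (X_coords r d) k"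
  interpret mpoly_prime ?V P using P by (rule fano_pointsD)
  have len: "length t = Suc k" using t(1) by (simp add: plucker_index_def)
  have dist: "distinct t" by (rule fano_points_distinct[OF P t(1,2)])
  obtain m where m: "\<And>i. i < r \<Longrightarrow> m i < d" "set t \<subseteq> (SIGMA i:{..<r}. {..<d} - {m i})"
    "card (SIGMA i:{..<r}. {..<d} - {m i}) = r * (d - 1)"
    using row_proper_transversal[OF t(3)] by metis
  have set_t: "set t = (SIGMA i:{..<r}. {..<d} - {m i})"
    by (intro card_subset_eq m(2)) (simp_all add: distinct_card[OF dist] len k m(3))
  have "\<exists>b. b \<le> k \<and> t ! b = (i, j)" if "i < r" "j < d" "j \<noteq> m i" for i j
  proof -
    have "(i, j) \<in> set t" using that by (simp add: set_t)
    then show ?thesis using len by (metis in_set_conv_nth less_Suc_eq_le)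
  qed
  then obtain idx where idx: "\<And>i j. i < r \<Longrightarrow> j < d \<Longrightarrow> j \<noteq> m i \<Longrightarrow> idx i j \<le> k \<and> t ! idx i j = (i, j)"
    by metis
  obtain i where i: "i < r" "c = (i, m i)"
    using c by (auto simp: set_t X_coords_def)
  define g0 where "g0 = (\<lambda>j\<in>{..<d}. if j = m i then a else idx i j)"
  have g0: "g0 \<in> {..<d} \<rightarrow>\<^sub>E {..k}"
    unfolding g0_def using idx[OF i(1)] a by (simp add: PiE_def Pi_def)
  have g0_other: "g0 j = idx i j" if "j < d" "j \<noteq> m i" for j using that by (simp add: g0_def)
  have g0_m: "g0 (m i) = a" using m(1)[OF i(1)] by (simp add: g0_def)
  let ?m = "choice_monomial d g0"
  let ?T = "\<lambda>(i, g). if choice_monomial d g = ?m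
    then \<Prod>j<d. mp_var (t[g j := (i, j)]) else 0 :: ((nat \<times> nat) list, 'a) mpoly"
  have index: "t[b := (i', j)] \<in> ?V" if "i' < r" "j < d" for b i' j
    using that t by (intro list_update_plucker_index) (simp_all add: X_coords_def)
  have other: "?T y \<in> P" if y: "y \<in> {..<r} \<times> ({..<d} \<rightarrow>\<^sub>E {..k})" "y \<noteq> (i, g0)" for y
  proof (rule ccontr)
    assume notP: "?T y \<notin> P"
    obtain i' g where y_eq: "y = (i', g)" by force
    have i': "i' < r" and g: "g \<in> {..<d} \<rightarrow>\<^sub>E {..k}" using y y_eq by auto
    have gk: "g j \<le> k" if "j < d" for j using g that by auto
    have mon: "choice_monomial d g = ?m" using notP by (auto simp: y_eq split: if_splits)
    have prodP: "(\<Prod>j<d. mp_var (t[g j := (i', j)])) \<notin> P" using notP mon by (simp add: y_eq)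
    have "mp_var (t[g j := (i', j)]) \<notin> P" if "j < d" for j
      using prodP that prod_mem[of "{..<d}" j "\<lambda>j. mp_var (t[g j := (i', j)])"]
        mpoly_var_closed[OF index[OF i']] by blast
    then have dist': "distinct (t[g j := (i', j)])" if "j < d" for j
      using that by (intro fano_points_distinct[OF P index[OF i']])
    \<comment> \<open>The entry \<open>(i', j)\<close> already occurs in \<open>t\<close>; at any
      other position it would be repeated, and coordinates of tuples with repetitions lie in
      \<open>P\<close>.\<close>
    have g_idx: "g j = idx i' j" if j: "j < d" "j \<noteq> m i'" for j
    proof (rule ccontr)
      assume ne: "g j \<noteq> idx i' j"
      then have "t[g j := (i', j)] ! idx i' j = t[g j := (i', j)] ! g j"
        using idx[OF i' j] gk[OF j(1)] len by simp
      then show False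
        using nth_eq_iff_index_eq[OF dist'[OF j(1)], of "idx i' j" "g j"] ne idx[OF i' j] gk[OF j(1)] len
        by simp
    qed
    show False
    proof (cases "i' = i")
      case True
      have g_g0: "g j = g0 j" if "j < d" "j \<noteq> m i" for j
        using g_idx[of j] g0_other[of j] that True by simp
      have "g (m i) = g0 (m i)"
        by (rule choice_monomial_cancel[OF mon m(1)[OF i(1)] g_g0])
      then have "g = g0"
        using g_g0 by (intro PiE_ext[OF g g0]) (metis lessThan_iff)
      then show False using y(2) y_eq True by simp
    next
      case False
      \<comment> \<open>The position must occur in the monomial; those holding entries of row
        \<open>i\<close> are excluded, which leaves \<open>a\<close>.\<close>
      have idx_a: "idx i' j = a" if j: "j < d" "j \<noteq> m i'" for j
      proof -
        have "g j \<in> g0 ` {..<d}"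
          using choice_monomial_eq_image[OF mon] j(1) by (metis imageI lessThan_iff)
        then obtain j' where j': "j' < d" "idx i' j = g0 j'"
          using g_idx[OF j] by (metis imageE lessThan_iff)
        have "j' = m i"
        proof (rule ccontr)
          assume "j' \<noteq> m i"
          then have "(i', j) = (i, j')"
            using idx[OF i' j] idx[OF i(1) j'(1)] g0_other[OF j'(1)] j'(2) by metis
          then show False using False by simp
        qed
        then show ?thesis using j'(2) g0_m by simp
      qed
      \<comment> \<open>Here \<open>d >= 3\<close> enters: row \<open>i'\<close> has two entries
        besides the missing one, and they cannot both sit at position \<open>a\<close>.\<close>
      obtain j1 j2 where j: "j1 < d" "j2 < d" "j1 \<noteq> j2" "j1 \<noteq> m i'" "j2 \<noteq> m i'"
      proof (cases "m i' = 0")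
        case True
        then show ?thesis using that[of 1 2] d by simp
      next
        case False
        show ?thesis
        proof (cases "m i' = 1")
          case True
          then show ?thesis using that[of 0 2] d by simp
        next
          case F: False
          then show ?thesis using that[of 0 1] d False by simp
        qed
      qed
      then show False
        using idx[OF i' j(1,4)] idx[OF i' j(2,5)] idx_a[OF j(1,4)] idx_a[OF j(2,5)] by simp
    qed
  qed
  have "(\<Sum>y\<in>{..<r} \<times> ({..<d} \<rightarrow>\<^sub>E {..k}). ?T y) \<in> P"
    using fano_pointsD(4)[OF P t(1), of ?m] by (simp add: fano_coeff_def)
  then have "?T (i, g0) \<in> P"
    by (subst (asm) sum_mem_iff[of _ "(i, g0)"]) (use i g0 other in \<open>auto simp: finite_PiE\<close>)
  then have "(\<Prod>j<d. mp_var (t[g0 j := (i, j)])) \<in> P" by simp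
  also have "(\<Prod>j<d. mp_var (t[g0 j := (i, j)])) = mp_var (t[a := c]) *
      (\<Prod>j\<in>{..<d} - {m i}. mp_var (t[g0 j := (i, j)]))"
    using m(1)[OF i(1)] by (simp add: prod.remove g0_m i(2))
  also have "(\<Prod>j\<in>{..<d} - {m i}. mp_var (t[g0 j := (i, j)])) = (\<Prod>j\<in>{..<d} - {m i}. mp_var t)"
  proof (rule prod.cong[OF refl])
    fix j assume "j \<in> {..<d} - {m i}"
    then have "t[g0 j := (i, j)] = t"
      using idx[OF i(1), of j] g0_other[of j] by (metis DiffE insertI1 lessThan_iff list_update_id)
    then show "mp_var (t[g0 j := (i, j)]) = mp_var t" by simp
  qed
  also have "\<dots> = mp_var t ^ card ({..<d} - {m i})" by simp
  finally have "mp_var (t[a := c]) \<in> P \<or> mp_var t ^ card ({..<d} - {m i}) \<in> P"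
    using c(1) t(1)
    by (intro prime_mem mpoly_power_closed mpoly_var_closed list_update_plucker_index)
  then show ?thesis using power_mem t(1,2) by blast
qed

text \<open>If \<open>s ! b\<close> is not in \<open>t\<close>, every term of the exchange relation
  for \<open>p_t p_s\<close> contains a coordinate of some \<open>t[a := s ! b]\<close>, which
  vanishes at \<open>P\<close>; then so would \<open>p_t\<close> or \<open>p_s\<close>.\<close>

lemma fano_points_max_unique:
  assumes P: "P \<in> fano_points r d k" and k: "Suc k = r * (d - 1)" and d: "3 \<le> d"
    and t: "t \<in> plucker_index (X_coords r d) k" "mp_var t \<notin> P" "row_proper r d (set t)"
    and s: "s \<in> plucker_index (X_coords r d) k" "mp_var s \<notin> P"
  shows "set s = set t"
proof (rule ccontr)
  assume ne: "set s \<noteq> set t"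
  let ?V = "plucker_index (X_coords r d) k"
  interpret mpoly_prime ?V P using P by (rule fano_pointsD)
  have len: "length t = Suc k" "length s = Suc k" and sub: "set s \<subseteq> X_coords r d"
    using t(1) s(1) by (auto simp: plucker_index_def)
  have dist: "distinct t" "distinct s"
    using fano_points_distinct[OF P] t s by blast+
  have "\<not> set s \<subseteq> set t"
    using ne card_subset_eq[of "set t" "set s"] len by (auto simp: distinct_card dist)
  then obtain c where "c \<in> set s" "c \<notin> set t" by blast
  then obtain b where b: "b < Suc k" "s ! b \<in> X_coords r d" "s ! b \<notin> set t"
    using len(2) sub by (metis in_set_conv_nth subsetD)
  have "(\<Sum>a<Suc k. mp_var (t[a := s ! b]) * mp_var (s[b := t ! a])) \<in> P"
  proof (rule sum_mem)
    fix a assume "a \<in> {..<Suc k}"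
    then have a: "a \<le> k" by simp
    have "t ! a \<in> X_coords r d"
      using t(1) a nth_mem[of a t] by (auto simp: plucker_index_def)
    then show "mp_var (t[a := s ! b]) * mp_var (s[b := t ! a]) \<in> P"
      using s(1) by (intro mult_mem_right fano_points_max_update[OF P k d t b(2,3) a]
          mpoly_var_closed list_update_plucker_index)
  qed
  moreover have "mp_var t * mp_var s - (\<Sum>a<Suc k. mp_var (t[a := s ! b]) * mp_var (s[b := t ! a])) \<in> P"
    by (rule fano_pointsD(3)[OF P plucker_exchange[OF t(1) s(1) b(1)]])
  ultimately have "mp_var t * mp_var s \<in> P"
    using add_mem by fastforce
  then show False
    using prime_mem[of "mp_var t" "mp_var s"] t s mpoly_var_closed by blast
qed

section \<open>Separating weights\<close>

text \<open>The lowest digit is divisible by 3 and at most 2 in absolute value, hence zero; divide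
  by 3 and repeat.\<close>

lemma ternary_digits_zero:
  fixes c :: "nat \<Rightarrow> int"
  assumes "\<And>n. n < N \<Longrightarrow> \<bar>c n\<bar> \<le> 2" "(\<Sum>n<N. c n * 3 ^ n) = 0" "n < N"
  shows "c n = 0"
  using assms
proof (induction N arbitrary: c n)
  case (Suc N)
  have "(\<Sum>n<Suc N. c n * 3 ^ n) = c 0 + 3 * (\<Sum>n<N. c (Suc n) * 3 ^ n)"
    by (simp add: sum.lessThan_Suc_shift sum_distrib_left ac_simps del: sum.lessThan_Suc)
  then have eq: "c 0 + 3 * (\<Sum>n<N. c (Suc n) * 3 ^ n) = 0"
    using Suc.prems(2) by simp
  then have c0: "c 0 = 0" using Suc.prems(1)[of 0] by presburger
  then have rest: "(\<Sum>n<N. c (Suc n) * 3 ^ n) = 0" using eq by simp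
  show ?case
  proof (cases n)
    case (Suc l)
    have "c (Suc l) = 0"
      by (rule Suc.IH[of "\<lambda>n. c (Suc n)" l]) (use Suc.prems rest \<open>n = Suc l\<close> in auto)
    then show ?thesis using Suc by simp
  qed (simp add: c0)
qed simp

lemma ternary_digits_zero_on:
  fixes c :: "'b \<Rightarrow> int" and e :: "'b \<Rightarrow> nat"
  assumes I: "finite I" "inj_on e I" and c: "\<And>x. x \<in> I \<Longrightarrow> \<bar>c x\<bar> \<le> 2"
    and sum: "(\<Sum>x\<in>I. c x * 3 ^ e x) = 0" and x: "x \<in> I"
  shows "c x = 0"
proof -
  define c' where "c' n = (if n \<in> e ` I then c (inv_into I e n) else 0)" for n
  define N where "N = Suc (Max (e ` I))"
  have N: "e y < N" if "y \<in> I" for y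
    using that I(1) by (simp add: N_def less_Suc_eq_le)
  have c'e: "c' (e y) = c y" if "y \<in> I" for y
    using that I(2) by (simp add: c'_def)
  have "(\<Sum>n<N. c' n * 3 ^ n) = (\<Sum>n\<in>e ` I. c' n * 3 ^ n)"
    using N by (intro sum.mono_neutral_right) (auto simp: c'_def)
  also have "\<dots> = (\<Sum>x\<in>I. c x * 3 ^ e x)"
    by (simp add: sum.reindex[OF I(2)] c'e)
  finally have sum': "(\<Sum>n<N. c' n * 3 ^ n) = 0" using sum by simp
  have c': "\<bar>c' n\<bar> \<le> 2" for n
    using c c'e by (cases "n \<in> e ` I") (auto simp: c'_def)
  have "c' (e x) = 0" by (rule ternary_digits_zero[OF c' sum' N[OF x]])
  then show ?thesis using c'e[OF x] by simp
qed

text \<open>Any weights with vanishing row sums that separate the row-proper sets would do.\<close>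

definition sep_weight :: "nat \<Rightarrow> nat \<times> nat \<Rightarrow> int" where
  "sep_weight d = (\<lambda>(i, j). if j < d - 1 then 3 ^ prod_encode (i, j)
     else - (\<Sum>l<d - 1. 3 ^ prod_encode (i, l)))"

lemma sum_sep_weight_row:
  assumes "0 < d"
  shows "(\<Sum>j<d. sep_weight d (i, j)) = 0"
proof -
  obtain d' where "d = Suc d'" using assms gr0_implies_Suc by blast
  then show ?thesis by (simp add: sep_weight_def)
qed

text \<open>Eliminating the last column by the zero row sums leaves an expansion in distinct powers
  of 3 with digits -1, 0, 1.\<close>

lemma sum_sep_weight:
  assumes S: "S \<subseteq> X_coords r (Suc d)"
  shows "sum (sep_weight (Suc d)) S =
    (\<Sum>(i, j)\<in>{..<r} \<times> {..<d}. (of_bool ((i, j) \<in> S) - of_bool ((i, d) \<in> S)) * 3 ^ prod_encode (i, j))"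
proof -
  have row: "(\<Sum>j<Suc d. of_bool ((i, j) \<in> S) * sep_weight (Suc d) (i, j)) =
      (\<Sum>j<d. (of_bool ((i, j) \<in> S) - of_bool ((i, d) \<in> S)) * 3 ^ prod_encode (i, j))" for i
    by (simp add: sep_weight_def left_diff_distrib sum_subtractf sum_distrib_left)
  have "sum (sep_weight (Suc d)) S = (\<Sum>x\<in>X_coords r (Suc d). of_bool (x \<in> S) * sep_weight (Suc d) x)"
    using S by (intro sum.mono_neutral_cong_left) (auto simp: X_coords_def)
  also have "\<dots> = (\<Sum>i<r. \<Sum>j<Suc d. of_bool ((i, j) \<in> S) * sep_weight (Suc d) (i, j))"
    unfolding X_coords_def by (subst sum.cartesian_product) (simp add: case_prod_beta)
  also have "\<dots> = (\<Sum>(i, j)\<in>{..<r} \<times> {..<d}.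
      (of_bool ((i, j) \<in> S) - of_bool ((i, d) \<in> S)) * 3 ^ prod_encode (i, j))"
    unfolding row by (rule sum.cartesian_product)
  finally show ?thesis .
qed

lemma inj_on_sum_sep_weight:
  assumes "0 < d"
  shows "inj_on (sum (sep_weight d)) {S. row_proper r d S}"
proof (rule inj_onI, unfold mem_Collect_eq)
  fix S T assume S: "row_proper r d S" and T: "row_proper r d T"
    and eq: "sum (sep_weight d) S = sum (sep_weight d) T"
  obtain d' where d: "d = Suc d'" using assms gr0_implies_Suc by blast
  define D where "D U = (\<lambda>(i, j). of_bool ((i, j) \<in> U) - of_bool ((i, d') \<in> U) :: int)" for U :: "(nat \<times> nat) set"
  have sum_D: "sum (sep_weight d) U = (\<Sum>x\<in>{..<r} \<times> {..<d'}. D U x * 3 ^ prod_encode x)"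
    if "row_proper r d U" for U
    unfolding d using that sum_sep_weight[of U r d']
    by (simp add: row_proper_def d D_def case_prod_beta)
  have "D S x - D T x = 0" if "x \<in> {..<r} \<times> {..<d'}" for x
  proof (rule ternary_digits_zero_on[OF _ _ _ _ that])
    show "inj_on prod_encode ({..<r} \<times> {..<d'})" by (rule inj_prod_encode)
    show "(\<Sum>x\<in>{..<r} \<times> {..<d'}. (D S x - D T x) * 3 ^ prod_encode x) = 0"
      using eq sum_D[OF S] sum_D[OF T] by (simp add: left_diff_distrib sum_subtractf)
  qed (auto simp: D_def)
  then have D_eq: "D S (i, j) = D T (i, j)" if "i < r" "j < d'" for i j
    using that by fastforce
  \<comment> \<open>The digits of a full row agree with those of an empty one. If a row-proper set
    contains the last entry of a row, some digit there is -1, and such a digit only occurs for sets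
    containing that entry.\<close>
  have last: "(i, d') \<in> U'" if L: "i < r" "(i, d') \<in> U" "row_proper r d U"
    "\<And>j. j < d' \<Longrightarrow> D U (i, j) = D U' (i, j)" for i U U'
  proof -
    obtain j where j: "j < Suc d'" "(i, j) \<notin> U" using L by (auto simp: row_proper_def d)
    then have "j < d'" using L(2) less_antisym by blast
    then have "D U' (i, j) = - 1" using L(2) L(4)[of j] j(2) by (simp add: D_def)
    then show ?thesis by (auto simp: D_def of_bool_def split: if_splits)
  qed
  have last_iff: "(i, d') \<in> S \<longleftrightarrow> (i, d') \<in> T" if "i < r" for i
    using last[OF that _ S, of T] last[OF that _ T, of S] D_eq that by metis
  have "x \<in> S \<longleftrightarrow> x \<in> T" if x: "x \<in> X_coords r d" for x
  proof -
    obtain i j where ij: "x = (i, j)" "i < r" "j < Suc d'" using x by (auto simp: X_coords_def d)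
    show ?thesis
    proof (cases "j = d'")
      case False
      then show ?thesis
        using D_eq[of i j] last_iff[of i] ij by (auto simp: D_def of_bool_def split: if_splits)
    qed (use last_iff ij in simp)
  qed
  then show "S = T" using S T unfolding row_proper_def by blast
qed

section \<open>Connectedness\<close>

text \<open>A nonvanishing coordinate of maximal weight exists because there are finitely many
  coordinates and \<open>P\<close> does not contain all of them.\<close>

lemma fano_point_specializes:
  fixes P :: "((nat \<times> nat) list, 'a::field) mpoly set"
  assumes P: "P \<in> fano_points r d k" and d: "2 \<le> d"
  obtains t R where "t \<in> plucker_index (X_coords r d) k" "distinct t" "row_proper r d (set t)"
    and "R \<in> fano_points r d k" "R \<subseteq> P" "R \<subseteq> coord_point r d k t"
proof -
  let ?V = "plucker_index (X_coords r d) k"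
  let ?A = "{t \<in> ?V. mp_var t \<notin> P}" and ?w = "tuple_weight k (sep_weight d)"
  have "finite ?A" using finite_plucker_index[OF finite_X_coords] by simp
  moreover have "?A \<noteq> {}" using proj_pointD(3)[OF fano_pointsD(1)[OF P]] by blast
  ultimately have "Max (?w ` ?A) \<in> ?w ` ?A" by (intro Max_in) auto
  then obtain t where t: "t \<in> ?A" "?w t = Max (?w ` ?A)" by (metis (no_types, lifting) imageE)
  have max: "?w s \<le> ?w t" if "s \<in> ?V" "mp_var s \<notin> P" for s
    unfolding t(2) using that \<open>finite ?A\<close> by (intro Max_ge) auto
  have w0: "(\<Sum>j<d. sep_weight d (i, j)) = 0" for i
    using sum_sep_weight_row d by simp
  have tV: "t \<in> ?V" "mp_var t \<notin> P" using t(1) by auto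
  have inj: "inj_on (sum (sep_weight d)) {S. row_proper r d S}"
    using inj_on_sum_sep_weight d by simp
  obtain R where "R \<in> fano_points r d k" "R \<subseteq> P" "R \<subseteq> coord_point r d k t"
    "row_proper r d (set t)" "distinct t"
    using degeneration[OF P d w0 inj tV max] by metis
  then show thesis using that tV(1) by blast
qed

text \<open>Both tuples describe the same plane. Instead of comparing ideals, the point of
  \<open>t'\<close> is degenerated towards \<open>t\<close>: its nonvanishing coordinates are
  rearrangements of \<open>t\<close>, so \<open>t\<close> has maximal weight among them.\<close>

lemma coord_point_permuted:
  assumes t: "t \<in> plucker_index (X_coords r d) k" "distinct t" "row_proper r d (set t)"
    and t': "t' \<in> plucker_index (X_coords r d) k" "distinct t'" "set t' = set t" and d: "2 \<le> d"
  obtains R where "R \<in> fano_points r d k" "R \<subseteq> coord_point r d k t'"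
    "R \<subseteq> (coord_point r d k t :: ((nat \<times> nat) list, 'a::field) mpoly set)"
proof -
  let ?V = "plucker_index (X_coords r d) k"
  have len: "length s = Suc k" if "s \<in> ?V" for s using that by (simp add: plucker_index_def)
  have P: "(coord_point r d k t' :: (_, 'a) mpoly set) \<in> fano_points r d k"
    using t t' by (intro coord_point_fano_points) auto
  have "minor k (coord_mat t') t' = (minor k (coord_mat t) t' * minor k (coord_mat t') t :: 'a)"
    using t'(3) by (intro minor_subset t t' len) auto
  then have "minor k (coord_mat t') t \<noteq> (0 :: 'a)"
    using minor_coord_mat_self[OF t'(2) len[OF t'(1)], where 'b = 'a] by auto
  then have tP: "mp_var t \<notin> (coord_point r d k t' :: (_, 'a) mpoly set)"
    using mp_var_mem_coord_point[OF t(1)] by blast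
  have max: "tuple_weight k (sep_weight d) s \<le> tuple_weight k (sep_weight d) t"
    if s: "s \<in> ?V" "mp_var s \<notin> (coord_point r d k t' :: (_, 'a) mpoly set)" for s
  proof -
    have E: "minor k (coord_mat t') s \<noteq> (0 :: 'a)" using mp_var_mem_coord_point[OF s(1)] s(2) by blast
    have ds: "distinct s" using minor_not_distinct[OF _ len[OF s(1)]] E by blast
    have "set s \<subseteq> set t" using minor_coord_mat_eq_0[OF len[OF s(1)] len[OF t'(1)]] E t'(3) by blast
    then have "set s = set t"
      by (intro card_subset_eq) (simp_all add: distinct_card ds t(2) len[OF s(1)] len[OF t(1)])
    then show ?thesis
      by (simp add: tuple_weight_distinct[OF len[OF s(1)] ds] tuple_weight_distinct[OF len[OF t(1)] t(2)])
  qed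
  have w0: "(\<Sum>j<d. sep_weight d (i, j)) = 0" for i
    using sum_sep_weight_row d by simp
  have inj: "inj_on (sum (sep_weight d)) {S. row_proper r d S}"
    using inj_on_sum_sep_weight d by simp
  obtain R where "R \<in> fano_points r d k" "R \<subseteq> coord_point r d k t'"
    "R \<subseteq> (coord_point r d k t :: (_, 'a) mpoly set)"
    using degeneration[OF P d w0 inj t(1) tP max] by metis
  then show thesis by (rule that)
qed

lemma clopen_fano_generization:
  assumes "openin (fano_scheme (X_coords r d) (X_form r d) k) T"
    and "closedin (fano_scheme (X_coords r d) (X_form r d) k) T"
    and "P \<in> fano_points r d k" "P' \<in> fano_points r d k" "R \<in> fano_points r d k" "R \<subseteq> P" "R \<subseteq> P'"
  shows "P \<in> T \<longleftrightarrow> P' \<in> T"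
proof -
  have Z: "fano_points r d k \<subseteq> proj_points (plucker_index (X_coords r d) k)"
    by (auto simp: fano_points_def)
  note gen = clopen_zariski_generization[OF assms(1,2)[unfolded fano_scheme_X_form] Z]
  show ?thesis using gen[OF assms(3,5,6)] gen[OF assms(4,5,7)] by simp
qed

text \<open>Below the maximal size, any two row-proper sets are joined by a chain of exchanges \<open>S \<mapsto> S - x + c\<close>
  with \<open>S + c\<close> row-proper. If no exchange brings \<open>t\<close> closer to \<open>t'\<close> directly, two of them do: first an
  auxiliary element \<open>c\<close> replaces \<open>x\<close>, then \<open>b\<close> replaces \<open>c\<close>.\<close>

lemma coord_points_clopen:
  fixes T :: "((nat \<times> nat) list, 'a::field) mpoly set set"
  assumes T: "openin (fano_scheme (X_coords r d) (X_form r d) k) T"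
      "closedin (fano_scheme (X_coords r d) (X_form r d) k) T"
    and d: "2 \<le> d" and k: "Suc k < r * (d - 1)"
    and t: "t \<in> plucker_index (X_coords r d) k" "distinct t" "row_proper r d (set t)"
    and t': "t' \<in> plucker_index (X_coords r d) k" "distinct t'" "row_proper r d (set t')"
  shows "coord_point r d k t \<in> T \<longleftrightarrow> coord_point r d k t' \<in> T"
  using t
proof (induction "card (set t' - set t)" arbitrary: t rule: less_induct)
  case less
  let ?V = "plucker_index (X_coords r d) k"
  note t = less.prems
  have len: "length s = Suc k" if "s \<in> ?V" for s using that by (simp add: plucker_index_def)
  have cards: "card (set t) = Suc k" "card (set t') = Suc k"
    using t t' by (simp_all add: distinct_card len)
  have move: "s[a := c] \<in> ?V \<and> distinct (s[a := c]) \<and> set (s[a := c]) = insert c (set s - {s ! a}) \<and>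
      row_proper r d (set (s[a := c])) \<and>
      (coord_point r d k s \<in> T \<longleftrightarrow> coord_point r d k (s[a := c]) \<in> T)"
    if s: "s \<in> ?V" "distinct s" "row_proper r d (insert c (set s))" and c: "c \<notin> set s" and a: "a \<le> k"
    for s a c
  proof -
    have "c \<in> X_coords r d" using s(3) by (simp add: row_proper_def)
    then have V: "s[a := c] \<in> ?V" using s(1) by (rule list_update_plucker_index[rotated])
    have dist: "distinct (s[a := c])" using s(2) c by (intro distinct_list_update) auto
    have set: "set (s[a := c]) = insert c (set s - {s ! a})"
      using s(2) a len[OF s(1)] by (intro set_update_distinct) auto
    have mono: "row_proper r d U" if "U \<subseteq> insert c (set s)" for U
      using s(3) that unfolding row_proper_def by blast
    have proper: "row_proper r d (set s)" "row_proper r d (set (s[a := c]))"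
      by (rule mono; auto simp: set)+
    obtain R where "R \<in> fano_points r d k" "R \<subseteq> (coord_point r d k s :: (_, 'a) mpoly set)"
      "R \<subseteq> coord_point r d k (s[a := c])"
      using line_of_planes[OF s(1,2) a s(3)] by metis
    then have "coord_point r d k s \<in> T \<longleftrightarrow> coord_point r d k (s[a := c]) \<in> T"
      using s V dist proper by (intro clopen_fano_generization[OF T] coord_point_fano_points)
    then show ?thesis using V dist set proper by blast
  qed
  show ?case
  proof (cases "set t' \<subseteq> set t")
    case True
    then have eq: "set t' = set t" using cards by (intro card_subset_eq) auto
    obtain R where "R \<in> fano_points r d k" "R \<subseteq> coord_point r d k t'"
      "R \<subseteq> (coord_point r d k t :: (_, 'a) mpoly set)"
      using coord_point_permuted[OF t t'(1,2) eq d] by metis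
    then show ?thesis
      using t t' by (intro clopen_fano_generization[OF T] coord_point_fano_points)
  next
    case False
    then obtain b where b: "b \<in> set t'" "b \<notin> set t" by blast
    \<comment> \<open>The induction measure drops when an element outside \<open>t'\<close> makes
      way for \<open>b\<close>.\<close>
    have closer: "card (set t' - insert b (set t - {x})) < card (set t' - set t)" if "x \<notin> set t'" for x
    proof (rule psubset_card_mono)
      show "set t' - insert b (set t - {x}) \<subset> set t' - set t" using b that by blast
    qed simp
    show ?thesis
    proof (cases "row_proper r d (insert b (set t))")
      case True
      have "\<not> set t \<subseteq> set t'"
        using b cards card_subset_eq[of "set t'" "set t"] by auto
      then obtain x where x: "x \<in> set t" "x \<notin> set t'" by blast
      then obtain a where a: "a \<le> k" "t ! a = x"
        using len[OF t(1)] by (metis in_set_conv_nth less_Suc_eq_le)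
      note m = move[OF t(1,2) True b(2) a(1)]
      have "coord_point r d k (t[a := b]) \<in> T \<longleftrightarrow> coord_point r d k t' \<in> T"
      proof (rule less.hyps)
        show "card (set t' - set (t[a := b])) < card (set t' - set t)"
          using m closer[OF x(2)] a(2) by simp
      qed (use m in blast)+
      then show ?thesis using m by simp
    next
      case nb: False
      obtain i j where ij: "b = (i, j)" "i < r" "j < d"
        using b(1) t'(3) by (force simp: row_proper_def X_coords_def)
      \<comment> \<open>Adding \<open>b\<close> can fill no row but its own, since \<open>t\<close>
        leaves a gap in every row.\<close>
      have full: "(i, l) \<in> insert b (set t)" if "l < d" for l
      proof -
        have "\<exists>i'<r. \<forall>l<d. (i', l) \<in> insert b (set t)"
          using nb t(3) ij by (auto simp: row_proper_def X_coords_def)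
        then obtain i' where i': "i' < r" "\<And>l. l < d \<Longrightarrow> (i', l) \<in> insert b (set t)" by blast
        moreover have "i' = i"
        proof (rule ccontr)
          assume "i' \<noteq> i"
          then have "(i', l) \<in> set t" if "l < d" for l using i'(2)[OF that] ij by auto
          then show False using t(3) i'(1) by (auto simp: row_proper_def)
        qed
        ultimately show ?thesis using that by blast
      qed
      \<comment> \<open>The gap of \<open>t'\<close> in this row marks an element of
        \<open>t\<close> that may be given up and whose removal makes room for
        \<open>b\<close>.\<close>
      obtain l where l: "l < d" "(i, l) \<notin> set t'" using t'(3) ij(2) by (auto simp: row_proper_def)
      define x where "x = (i, l)"
      have x: "x \<in> set t" "x \<notin> set t'" "x \<noteq> b"
        using full[OF l(1)] l(2) b(1) by (auto simp: x_def)
      obtain a where a: "a \<le> k" "t ! a = x"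
        using x(1) len[OF t(1)] by (metis in_set_conv_nth less_Suc_eq_le)
      obtain c where c: "c \<in> X_coords r d" "c \<notin> set t" "row_proper r d (insert c (set t))"
        using row_proper_extend[OF t(3)] cards k by metis
      have cb: "c \<noteq> b" using c(3) nb by blast
      note m1 = move[OF t(1,2) c(3,2) a(1)]
      have set1: "set (t[a := c]) = insert c (set t - {x})" using m1 a(2) by simp
      have proper2: "row_proper r d (insert b (set (t[a := c])))"
        unfolding row_proper_def
      proof (intro conjI allI impI)
        show "insert b (set (t[a := c])) \<subseteq> X_coords r d"
          using b(1) t'(3) m1 by (auto simp: row_proper_def)
        fix i' assume i': "i' < r"
        show "\<exists>j<d. (i', j) \<notin> insert b (set (t[a := c]))"
        proof (cases "i' = i")
          case True
          have "x \<notin> insert b (set (t[a := c]))" using x c(2) unfolding set1 by auto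
          then show ?thesis using l(1) True by (auto simp: x_def)
        next
          case False
          obtain j' where "j' < d" "(i', j') \<notin> insert c (set t)"
            using c(3) i' by (auto simp: row_proper_def)
          then show ?thesis using False ij(1) unfolding set1 by (intro exI[of _ j']) auto
        qed
      qed
      have b1: "b \<notin> set (t[a := c])" using b(2) cb unfolding set1 by blast
      have V1: "t[a := c] \<in> ?V" "distinct (t[a := c])" using m1 by blast+
      note m2 = move[OF V1 proper2 b1 a(1), unfolded list_update_overwrite]
      have nth: "t[a := c] ! a = c" using a(1) len[OF t(1)] by simp
      have "set (t[a := b]) = insert b (set (t[a := c]) - {c})"
        using m2 nth by metis
      then have set2: "set (t[a := b]) = insert b (set t - {x})"
        using c(2) unfolding set1 by blast
      have "coord_point r d k (t[a := b]) \<in> T \<longleftrightarrow> coord_point r d k t' \<in> T"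
      proof (rule less.hyps)
        show "card (set t' - set (t[a := b])) < card (set t' - set t)"
          using closer[OF x(2)] by (simp add: set2)
      qed (use m2 in blast)+
      then show ?thesis using m1 m2 by blast
    qed
  qed
qed

lemma exists_tuple:
  assumes "finite S" "card S = Suc k" "S \<subseteq> X_coords r d"
  obtains t where "t \<in> plucker_index (X_coords r d) k" "distinct t" "set t = S"
proof -
  obtain t where "set t = S" "distinct t" using finite_distinct_list[OF assms(1)] by blast
  then show thesis using that assms(2,3) by (auto simp: plucker_index_def distinct_card[symmetric])
qed

theorem theorem3p5:
  fixes r d k :: nat
    and F :: "((nat \<times> nat) list, 'a::alg_closed_field) mpoly set topology"
  assumes "r \<ge> 2" and "d \<ge> 3"
    and F: "F = fano_scheme (X_coords r d) (X_form r d) k"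
  shows "(topspace F \<noteq> {} \<longleftrightarrow> k < r * (d - 1)) \<and>
         (topspace F \<noteq> {} \<longrightarrow> (connected_space F \<longleftrightarrow> k < r * (d - 1) - 1))"
proof -
  let ?V = "plucker_index (X_coords r d) k"
  have top: "topspace F = fano_points r d k"
    unfolding F by (rule topspace_fano_scheme_X_form)
  have d: "2 \<le> d" using assms(2) by simp
  have len: "length s = Suc k" if "s \<in> ?V" for s using that by (simp add: plucker_index_def)
  have coords: "coord_point r d k t \<in> topspace F"
    if "t \<in> ?V" "distinct t" "row_proper r d (set t)" for t
    unfolding top using that by (rule coord_point_fano_points)
  have bound: "k < r * (d - 1)" if P: "P \<in> topspace F" for P
  proof -
    obtain t where "t \<in> ?V" "distinct t" "row_proper r d (set t)"
      using fano_point_specializes[OF P[unfolded top] d] by metis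
    then show ?thesis using row_proper_card(2)[of r d "set t"] len by (simp add: distinct_card)
  qed
  have nonempty: "topspace F \<noteq> {}" if "k < r * (d - 1)"
  proof -
    \<comment> \<open>Dropping the last column gives a row-proper set of the maximal size.\<close>
    have "Suc k \<le> card ({..<r} \<times> {..<d - 1})" using that by simp
    then obtain S where S: "S \<subseteq> {..<r} \<times> {..<d - 1}" "card S = Suc k" "finite S"
      by (rule obtain_subset_with_card_n)
    then have proper: "row_proper r d S"
      using d by (force simp: row_proper_def X_coords_def)
    then obtain t where "t \<in> ?V" "distinct t" "set t = S"
      using exists_tuple[OF S(3,2)] by (metis row_proper_def)
    then show ?thesis using coords[of t] proper by auto
  qed
  \<comment> \<open>The hypothesis amounts to \<open>Suc k < r * (d - 1)\<close>, so row-proper sets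
    of size \<open>Suc k\<close> can be enlarged.\<close>
  have connected: "connected_space F" if k: "k < r * (d - 1) - 1"
    unfolding connected_space_clopen_in
  proof (intro allI impI)
    fix T assume T: "openin F T \<and> closedin F T"
    note T = conjunct1[OF T, unfolded F] conjunct2[OF T, unfolded F]
    \<comment> \<open>Each point shares a generization with a coordinate plane, and no clopen set
      separates coordinate planes.\<close>
    have all: "P' \<in> T" if P: "P \<in> T" and P': "P' \<in> topspace F" for P P'
    proof -
      have PF: "P \<in> fano_points r d k"
        using P openin_subset[OF T(1)] top unfolding F by blast
      obtain t R where t: "t \<in> ?V" "distinct t" "row_proper r d (set t)"
        and R: "R \<in> fano_points r d k" "R \<subseteq> P" "R \<subseteq> coord_point r d k t"
        using fano_point_specializes[OF PF d] by metis
      obtain t' R' where t': "t' \<in> ?V" "distinct t'" "row_proper r d (set t')"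
        and R': "R' \<in> fano_points r d k" "R' \<subseteq> P'" "R' \<subseteq> coord_point r d k t'"
        using fano_point_specializes[OF P'[unfolded top] d] by metis
      have "coord_point r d k t \<in> T"
        using clopen_fano_generization[OF T PF coords[OF t, unfolded top] R] P by blast
      then have "coord_point r d k t' \<in> T"
        using coord_points_clopen[OF T d _ t t'] k by simp
      then show "P' \<in> T"
        using clopen_fano_generization[OF T P'[unfolded top] coords[OF t', unfolded top] R'] by blast
    qed
    show "T = {} \<or> T = topspace F"
      using all openin_subset[OF T(1)] unfolding F by blast
  qed
  have disconnected: "\<not> connected_space F" if k: "Suc k = r * (d - 1)"
  proof
    assume conn: "connected_space F"
    \<comment> \<open>Two different row-proper sets of maximal size: drop the last column or the
      first.\<close>
    let ?S0 = "{..<r} \<times> {..<d - 1}" and ?S1 = "{..<r} \<times> {1..<d}"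
    have "\<exists>j<d. (i, j) \<notin> ?S0" "\<exists>j<d. (i, j) \<notin> ?S1" for i
      using assms(2) by (auto intro: exI[of _ "d - 1"] exI[of _ 0])
    then have S: "row_proper r d ?S0" "row_proper r d ?S1" "card ?S0 = Suc k" "card ?S1 = Suc k"
      using k unfolding row_proper_def X_coords_def by auto
    obtain t0 where t0: "t0 \<in> ?V" "distinct t0" "set t0 = ?S0"
      using exists_tuple[of ?S0 k r d] S by (auto simp: row_proper_def)
    obtain t1 where t1: "t1 \<in> ?V" "distinct t1" "set t1 = ?S1"
      using exists_tuple[of ?S1 k r d] S by (auto simp: row_proper_def)
    have "(0, 0) \<in> ?S0 - ?S1" using assms(1,2) by auto
    then have ne: "set t1 \<noteq> set t0" unfolding t0(3) t1(3) by blast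
    have p0: "row_proper r d (set t0)" and p1: "row_proper r d (set t1)" using S t0 t1 by simp_all
    define U where "U = {P \<in> topspace F. mp_var t0 \<notin> P}"
    define W where "W = {s \<in> ?V. set s \<noteq> set t0}"
    have open_var: "openin F {P \<in> topspace F. \<exists>s\<in>W. mp_var s \<notin> P}" if "W \<subseteq> ?V" for W
    proof -
      have "mp_var ` W \<subseteq> carrier (mpoly_ring ?V)" using that by blast
      then have "openin (zariski ?V) (proj_points ?V - proj_closed ?V (mp_var ` W))"
        unfolding openin_zariski by blast
      moreover have "{P \<in> topspace F. \<exists>s\<in>W. mp_var s \<notin> P} =
          (proj_points ?V - proj_closed ?V (mp_var ` W)) \<inter> fano_points r d k"
        unfolding top by (auto simp: proj_closed_def fano_points_def)
      ultimately show ?thesis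
        unfolding F fano_scheme_X_form openin_subtopology by blast
    qed
    have "openin F U"
      using open_var[of "{t0}"] t0(1) by (simp add: U_def)
    \<comment> \<open>No point has nonvanishing coordinates on two different column sets, so the
      complement of the chart of \<open>t0\<close> is the union of the charts of the other column
      sets.\<close>
    moreover have "topspace F - U = {P \<in> topspace F. \<exists>s\<in>W. mp_var s \<notin> P}"
    proof -
      have "mp_var t0 \<in> P \<longleftrightarrow> (\<exists>s\<in>W. mp_var s \<notin> P)" if "P \<in> topspace F" for P
      proof -
        note P = that[unfolded top]
        interpret mpoly_prime ?V P using P by (rule fano_pointsD)
        have "mp_var s \<in> P" if "s \<in> W" "mp_var t0 \<notin> P" for s
          using fano_points_max_unique[OF P k assms(2) t0(1) that(2) p0] that(1)
          unfolding W_def by blast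
        moreover have "\<exists>s\<in>W. mp_var s \<notin> P" if t0P: "mp_var t0 \<in> P"
        proof -
          obtain s where s: "s \<in> ?V" "mp_var s \<notin> P"
            using proj_pointD(3)[OF fano_pointsD(1)[OF P]] by blast
          \<comment> \<open>Otherwise the coordinate of \<open>s\<close> would be a scalar multiple
            of that of \<open>t0\<close> modulo \<open>P\<close>.\<close>
          have "set s \<noteq> set t0"
          proof
            assume "set s = set t0"
            then have "mp_var s - mp_const (minor k (coord_mat t0) s) * mp_var t0 \<in> P"
              by (intro fano_pointsD(3)[OF P] plucker_subset t0 s) simp
            then have "mp_var s \<in> P"
              using add_mem[OF _ mult_mem_left[OF t0P mpoly_const_closed]] by (metis diff_add_cancel)
            then show False using s(2) by blast
          qed
          then show ?thesis using s unfolding W_def by blast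
        qed
        ultimately show ?thesis by blast
      qed
      then show ?thesis unfolding U_def by blast
    qed
    then have "openin F (topspace F - U)"
      using open_var[of W] unfolding W_def by auto
    then have "closedin F U"
      unfolding closedin_def U_def by blast
    ultimately have U: "U = {} \<or> U = topspace F"
      using conn unfolding connected_space_clopen_in by blast
    have self: "mp_var s \<notin> (coord_point r d k s :: ((nat \<times> nat) list, 'a) mpoly set)" if "s \<in> ?V" "distinct s" for s
      using mp_var_mem_coord_point[OF that(1), of s, where 'a = 'a]
        minor_coord_mat_self[OF that(2) len[OF that(1)], where 'b = 'a] by simp
    have "coord_point r d k t0 \<in> U"
      unfolding U_def using coords[OF t0(1,2) p0] self[OF t0(1,2)] by blast
    moreover have "coord_point r d k t1 \<notin> U"
    proof
      assume "coord_point r d k t1 \<in> U"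
      then have "mp_var t0 \<notin> (coord_point r d k t1 :: (_, 'a) mpoly set)"
        unfolding U_def by blast
      from fano_points_max_unique[OF coords[OF t1(1,2) p1, unfolded top] k assms(2) t0(1) this p0
          t1(1) self[OF t1(1,2)]]
      show False using ne by blast
    qed
    ultimately show False using U coords[OF t1(1,2) p1] by blast
  qed
  show ?thesis
  proof (cases "k < r * (d - 1)")
    case True
    then consider "k < r * (d - 1) - 1" | "Suc k = r * (d - 1)" by linarith
    then show ?thesis
      by cases (use True nonempty connected disconnected in auto)
  next
    case False
    then show ?thesis using bound by blast
  qed
qed

end
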